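(* Assume that $(H_\Phi)$ and $(H_T)$ (stated in the context) hold and suppose that $\bar x\in\mathrm{dom}\,\Lambda_0^*$. Then $\inf(P^{\bar x})<\infty$. If in addition $\bar x\in\mathrm{diffdom}\,\Lambda_0^*$, then the following statements hold true. (a) The primal problem $(P^{\bar x})$ is attained in $\mathcal{L}_1$ and the dual problem $(D_2^{\bar x})$ is attained in $\mathcal{X}_1^{\mathrm{alg}}$. (b) Any $\bar\ell\in\mathcal{L}_1$ is a solution to $(P^{\bar x})$ if and only if $T\bar\ell=\bar x$ and there exists $\bar\omega\in\mathcal{X}_1^{\mathrm{alg}}$ such that $\bar\ell\in\partial_{\mathcal{L}_1}\Phi_2(T_2^*\bar\omega)$, or equivalently $\Phi^*(\bar\ell)+\Phi_2(T_2^*\bar\omega)=\langle T\bar\ell,\bar\omega\rangle$. Moreover, this occurs if and only if: $\bar\ell$ is a solution to $(P^{\bar x})$, $\bar\omega$ is a solution to $(D_2^{\bar x})$ with $\bar x=T\bar\ell$, and $\inf(P^{\bar x})=\sup(D_2^{\bar x})$. (c) Any solution $\bar\omega$ of $(D_2^{\bar x})$ shares the following properties: (1) $\bar\omega$ lies in the $\sigma(\mathcal{X}_1^{\mathrm{alg}},\mathcal{X}_1)$-closure of $\mathrm{dom}\,\Lambda_1$; (2) $T_2^*\bar\omega$ lies in the $\sigma(\mathcal{L}_1^{\mathrm{alg}},\mathcal{L}_1)$-closures of $T_1^*(\mathrm{dom}\,\Lambda_1)$ and of $\mathrm{dom}\,\Phi$; (3) if $\bar x\in\mathrm{icordom}\,\Lambda_0^*$,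 then $\bar\omega$ is $j_{D_{\bar x}}$-upper semicontinuous and $j_{-D_{\bar x}}$-lower semicontinuous at $0$, where $D_{\bar x}=\{x\in\mathcal{X}_1;\Lambda_0^*(\bar x+x)\le\Lambda_0^*(\bar x)+1\}$ and $j_{D_{\bar x}},j_{-D_{\bar x}}$ are the gauge functionals on $\mathcal{X}_1$ of $D_{\bar x}$ and $-D_{\bar x}$.
   Context: All vector spaces are real. $E^{\mathrm{alg}}$ denotes the algebraic dual of $E$; $\sigma(E,F)$ is the weak topology on $E$ given by a dual pairing with $F$; $\mathrm{dom}\,f=\{f<+\infty\}$; $\mathrm{icordom}\,f$ is the intrinsic core of $\mathrm{dom}\,f$, i.e. the set of $x\in\mathrm{dom}\,f$ such that for every $x'$ in the affine hull of $\mathrm{dom}\,f$ there is $t>0$ with $[x,x+t(x'-x)]\subset\mathrm{dom}\,f$. Data. $\mathcal{U},\mathcal{Y}$ are vector spaces, $\mathcal{L}=\mathcal{U}^{\mathrm{alg}}$, $\mathcal{X}=\mathcal{Y}^{\mathrm{alg}}$, $\Phi$ is a function on $\mathcal{U}$, $T:\mathcal{L}\to\mathcal{X}$ is linear, $\bar x\in\mathcal{X}$. The adjoint $T^*:\mathcal{Y}\to\mathcal{L}^{\mathrm{alg}}$ is given by $\langle T^*y,\ell\rangle=\langle y,T\ell\rangle$; $\mathcal{U}$ is identified with a subspace of $\mathcal{L}^{\mathrm{alg}}$. Hypotheses. $(H_\Phi)$: (1) $\Phi:\mathcal{U}\to[0,+\infty]$ is convex and $\Phi(0)=0$; (2) for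 all $u\in\mathcal{U}$ there is $\alpha>0$ with $\Phi(\alpha u)<\infty$; (3) for all $u\in\mathcal{U}$, $u\neq0$, there is $t\in\mathbb{R}$ with $\Phi(tu)>0$. $(H_T)$: (1) $T^*(\mathcal{Y})\subset\mathcal{U}$; (2) $\ker T^*=\{0\}$. Norms and spaces. $\Phi_\pm(u)=\max(\Phi(u),\Phi(-u))$ and $|u|_\Phi=\inf\{\alpha>0;\Phi_\pm(u/\alpha)\le1\}$, a norm on $\mathcal{U}$. $\Lambda(y)=\Phi(T^*y)$, $\Lambda_\pm(y)=\max(\Lambda(y),\Lambda(-y))$, $|y|_\Lambda=\inf\{\alpha>0;\Lambda_\pm(y/\alpha)\le1\}=|T^*y|_\Phi$, a norm on $\mathcal{Y}$. $\mathcal{U}_1$ is the $|\cdot|_\Phi$-completion of $\mathcal{U}$ and $\mathcal{L}_1=(\mathcal{U},|\cdot|_\Phi)'\cong\mathcal{U}_1'$ its topological dual, seen as a subspace of $\mathcal{L}$. $\mathcal{Y}_1$ is the $|\cdot|_\Lambda$-completion of $\mathcal{Y}$ and $\mathcal{X}_1=(\mathcal{Y},|\cdot|_\Lambda)'\cong\mathcal{Y}_1'$, seen as a subspace of $\mathcal{X}$. Operators. One has $T\mathcal{L}_1\subset\mathcal{X}_1$. $T_2^*:\mathcal{X}_1^{\mathrm{alg}}\to\mathcal{L}_1^{\mathrm{alg}}$ is defined by $\langle\ell,T_2^*\omega\rangle=\langle T\ell,\omega\rangle$ for all $\ell\in\mathcal{L}_1$, and $T_1^*$ is its restriction to $\mathcal{Y}_1\subset\mathcal{X}_1^{\mathrm{alg}}$;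 one has $T_1^*\mathcal{Y}_1\subset\mathcal{U}_1$. Functions. $\Phi^*(\ell)=\sup_{u\in\mathcal{U}}\{\langle u,\ell\rangle-\Phi(u)\}$ for $\ell\in\mathcal{L}$. $\Phi_0(u)=\sup_{\ell\in\mathcal{L}}\{\langle u,\ell\rangle-\Phi^*(\ell)\}$ on $\mathcal{U}$; $\Phi_1(u)=\sup_{\ell\in\mathcal{L}_1}\{\langle u,\ell\rangle-\Phi^*(\ell)\}$ on $\mathcal{U}_1$; $\Phi_2(\zeta)=\sup_{\ell\in\mathcal{L}_1}\{\langle\ell,\zeta\rangle-\Phi^*(\ell)\}$ on $\mathcal{L}_1^{\mathrm{alg}}$. $\Lambda_0(y)=\Phi_0(T^*y)$ on $\mathcal{Y}$; $\Lambda_1(y)=\Phi_1(T_1^*y)$ on $\mathcal{Y}_1$; $\Lambda_2(\omega)=\Phi_2(T_2^*\omega)$ on $\mathcal{X}_1^{\mathrm{alg}}$. $\Lambda_0^*(x)=\sup_{y\in\mathcal{Y}}\{\langle y,x\rangle-\Lambda_0(y)\}$ on $\mathcal{X}$. $\ell\in\partial_{\mathcal{L}_1}\Phi_2(\zeta)$ means $\ell\in\mathcal{L}_1$ and $\Phi_2(\zeta+\xi)\ge\Phi_2(\zeta)+\langle\ell,\xi\rangle$ for all $\xi\in\mathcal{L}_1^{\mathrm{alg}}$. $\mathrm{diffdom}\,\Lambda_0^*$ is the set of $x\in\mathcal{X}_1$ for which there is $\omega\in\mathcal{X}_1^{\mathrm{alg}}$ with $\Lambda_0^*(x')\ge\Lambda_0^*(x)+\langle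 x'-x,\omega\rangle$ for all $x'\in\mathcal{X}_1$. Problems. $(P^{\bar x})$: minimize $\Phi^*(\ell)$ subject to $T\ell=\bar x$, $\ell\in\mathcal{L}$. $(D_2^{\bar x})$: maximize $\langle\bar x,\omega\rangle-\Lambda_2(\omega)$, $\omega\in\mathcal{X}_1^{\mathrm{alg}}$. The gauge of a convex set $D$ containing $0$ is $j_D(x)=\inf\{\alpha>0;x\in\alpha D\}\in[0,\infty]$. A linear form $\omega$ is $j$-upper (resp. $j$-lower) semicontinuous at $0$ if for every $\varepsilon>0$ there is $\delta>0$ such that $j(x)<\delta$ implies $\langle\omega,x\rangle<\varepsilon$ (resp. $\langle\omega,x\rangle>-\varepsilon$). *)

theory Defs
  imports "HOL-Analysis.Analysis"
begin

section \<open>Algebraic duals\<close>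

typedef (overloaded) 'a adual = "{f :: 'a::real_vector \<Rightarrow> real. linear f}"
  morphisms app Abs_adual
  by (auto intro: exI[of _ "\<lambda>_. 0"] linear_zero)

setup_lifting type_definition_adual

abbreviation pairing :: "'a::real_vector \<Rightarrow> 'a adual \<Rightarrow> real"  (\<open>\<langle>_, _\<rangle>\<close>)
  where "\<langle>u, l\<rangle> \<equiv> app l u"

lemma linear_app: "linear (app l)"
  using app[of l] by simp

instantiation adual :: (real_vector) real_vector
begin

lift_definition zero_adual :: "'a adual" is "\<lambda>_. 0"
  by (rule linear_zero)

lift_definition plus_adual :: "'a adual \<Rightarrow> 'a adual \<Rightarrow> 'a adual" is "\<lambda>f g u. f u + g u"
  by (rule linear_compose_add)

lift_definition uminus_adual :: "'a adual \<Rightarrow> 'a adual" is "\<lambda>f u. - f u"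
  by (rule linear_compose_neg)

lift_definition minus_adual :: "'a adual \<Rightarrow> 'a adual \<Rightarrow> 'a adual" is "\<lambda>f g u. f u - g u"
  by (rule linear_compose_sub)

lift_definition scaleR_adual :: "real \<Rightarrow> 'a adual \<Rightarrow> 'a adual" is "\<lambda>c f u. c * f u"
  using linear_compose_scale_right by force

instance
  by standard (transfer; simp add: fun_eq_iff algebra_simps)+

end

lemma app_simps [simp]:
  "\<langle>u, 0\<rangle> = 0" "\<langle>u, l + m\<rangle> = \<langle>u, l\<rangle> + \<langle>u, m\<rangle>" "\<langle>u, - l\<rangle> = - \<langle>u, l\<rangle>"
  "\<langle>u, l - m\<rangle> = \<langle>u, l\<rangle> - \<langle>u, m\<rangle>" "\<langle>u, c *\<^sub>R l\<rangle> = c * \<langle>u, l\<rangle>"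
  by (transfer; simp)+

lift_definition canon :: "'a::real_vector \<Rightarrow> 'a adual adual" is "\<lambda>u l. \<langle>u, l\<rangle>"
  by (rule linearI) simp_all

lemma app_canon [simp]: "\<langle>l, canon u\<rangle> = \<langle>u, l\<rangle>"
  by (simp add: canon.rep_eq)

lemma inj_canon: "inj canon"
proof (rule injI)
  fix u v :: 'a
  assume eq: "canon u = canon v"
  have "f u = f v" if "linear f" for f :: "'a \<Rightarrow> real"
  proof -
    have "\<langle>Abs_adual f, canon u\<rangle> = \<langle>Abs_adual f, canon v\<rangle>"
      by (simp only: eq)
    then show ?thesis
      using that by (simp add: Abs_adual_inverse)
  qed
  moreover have "\<exists>f :: 'a \<Rightarrow> real. linear f \<and> f (u - v) = 1" if "u - v \<noteq> 0"
    using linear_independent_extend[of "{u - v}" "\<lambda>_. 1 :: real"] that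
    by (auto simp: dependent_single)
  ultimately show "u = v"
    by (metis diff_self eq_iff_diff_eq_0 linear_diff zero_neq_one)
qed

text \<open>The algebraic dual of a linear subspace \<open>S\<close> of an ambient space. The value of a form off
  \<open>S\<close> is fixed by \<^const>\<open>extensional\<close>, so equality of such functions is equality of forms.\<close>

definition adual_on :: "'a::real_vector set \<Rightarrow> ('a \<Rightarrow> real) set" where
  "adual_on S = {\<omega> \<in> extensional S.
     (\<forall>x\<in>S. \<forall>y\<in>S. \<omega> (x + y) = \<omega> x + \<omega> y) \<and> (\<forall>c. \<forall>x\<in>S. \<omega> (c *\<^sub>R x) = c * \<omega> x)}"

text \<open>The weak topology of the pairing between \<^term>\<open>adual_on S\<close> and \<open>S\<close>.\<close>

definition weak_top :: "'a::real_vector set \<Rightarrow> ('a \<Rightarrow> real) topology" where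
  "weak_top S = topology_generated_by {{\<omega> \<in> adual_on S. \<omega> x \<in> V} | x V. x \<in> S \<and> open V}"

section \<open>Topological dual and completion for a norm given as a function\<close>

abbreviation ndist :: "('a::real_vector \<Rightarrow> real) \<Rightarrow> 'a \<Rightarrow> 'a \<Rightarrow> real" where
  "ndist nrm \<equiv> (\<lambda>u v. nrm (u - v))"

definition top_dual :: "('a::real_vector \<Rightarrow> real) \<Rightarrow> 'a adual set" where
  "top_dual nrm =
     {l. continuous_map (Metric_space.mtopology UNIV (ndist nrm)) euclideanreal (app l)}"

definition cauchy_equiv :: "('a::real_vector \<Rightarrow> real) \<Rightarrow> ((nat \<Rightarrow> 'a) \<times> (nat \<Rightarrow> 'a)) set" where
  "cauchy_equiv nrm =
     {(s, t). Metric_space.MCauchy UNIV (ndist nrm) s \<and> Metric_space.MCauchy UNIV (ndist nrm) t \<and>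
              (\<lambda>n. nrm (s n - t n)) \<longlonglongrightarrow> 0}"

definition completion :: "('a::real_vector \<Rightarrow> real) \<Rightarrow> (nat \<Rightarrow> 'a) set set" where
  "completion nrm = {s. Metric_space.MCauchy UNIV (ndist nrm) s} // cauchy_equiv nrm"

text \<open>The pairing of a point of the completion with a continuous linear form \<open>l\<close>, that is, the
  value of the continuous extension of \<open>l\<close>.\<close>

definition cpair :: "(nat \<Rightarrow> 'a::real_vector) set \<Rightarrow> 'a adual \<Rightarrow> real" where
  "cpair c l = (THE r. \<forall>s\<in>c. (\<lambda>n. \<langle>s n, l\<rangle>) \<longlonglongrightarrow> r)"

text \<open>The canonical embedding of the completion into the algebraic dual of the topological dual.\<close>

definition cemb ::
    "('a::real_vector \<Rightarrow> real) \<Rightarrow> (nat \<Rightarrow> 'a) set \<Rightarrow> 'a adual \<Rightarrow> real" where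
  "cemb nrm c = restrict (cpair c) (top_dual nrm)"

section \<open>Convexity, domains, gauges\<close>

definition ereal_convex :: "('a::real_vector \<Rightarrow> ereal) \<Rightarrow> bool" where
  "ereal_convex f \<longleftrightarrow> (\<forall>u v. \<forall>t\<in>{0<..<1}.
     f ((1 - t) *\<^sub>R u + t *\<^sub>R v) \<le> ereal (1 - t) * f u + ereal t * f v)"

definition edom :: "('a \<Rightarrow> ereal) \<Rightarrow> 'a set" where
  "edom f = {x. f x < \<infinity>}"

definition icor :: "'a::real_vector set \<Rightarrow> 'a set" where
  "icor D = {x \<in> D. \<forall>x'\<in>affine hull D. \<exists>t>0. closed_segment x (x + t *\<^sub>R (x' - x)) \<subseteq> D}"

definition gauge_fun :: "'a::real_vector set \<Rightarrow> 'a \<Rightarrow> ereal" where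
  "gauge_fun D x = Inf (ereal ` {\<alpha>. 0 < \<alpha> \<and> x \<in> (*\<^sub>R) \<alpha> ` D})"

text \<open>Semicontinuity at \<open>0\<close> of a form on a subspace \<open>S\<close> with respect to a gauge on \<open>S\<close>.\<close>

definition gauge_usc :: "'a set \<Rightarrow> ('a \<Rightarrow> ereal) \<Rightarrow> ('a \<Rightarrow> real) \<Rightarrow> bool" where
  "gauge_usc S j \<omega> \<longleftrightarrow> (\<forall>\<epsilon>>0. \<exists>\<delta>>0. \<forall>x\<in>S. j x < ereal \<delta> \<longrightarrow> \<omega> x < \<epsilon>)"

definition gauge_lsc :: "'a set \<Rightarrow> ('a \<Rightarrow> ereal) \<Rightarrow> ('a \<Rightarrow> real) \<Rightarrow> bool" where
  "gauge_lsc S j \<omega> \<longleftrightarrow> (\<forall>\<epsilon>>0. \<exists>\<delta>>0. \<forall>x\<in>S. j x < ereal \<delta> \<longrightarrow> \<omega> x > - \<epsilon>)"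

definition sym_max :: "('a::real_vector \<Rightarrow> ereal) \<Rightarrow> 'a \<Rightarrow> ereal" where
  "sym_max F u = max (F u) (F (- u))"

definition lux :: "('a::real_vector \<Rightarrow> ereal) \<Rightarrow> 'a \<Rightarrow> real" where
  "lux F u = Inf {\<alpha>. 0 < \<alpha> \<and> sym_max F (u /\<^sub>R \<alpha>) \<le> 1}"

section \<open>The data\<close>

definition H_Phi :: "('u::real_vector \<Rightarrow> ereal) \<Rightarrow> bool" where
  "H_Phi \<Phi> \<longleftrightarrow>
     ((\<forall>u. 0 \<le> \<Phi> u) \<and> ereal_convex \<Phi> \<and> \<Phi> 0 = 0) \<and>
     (\<forall>u. \<exists>\<alpha>>0. \<Phi> (\<alpha> *\<^sub>R u) < \<infinity>) \<and>
     (\<forall>u. u \<noteq> 0 \<longrightarrow> (\<exists>t. \<Phi> (t *\<^sub>R u) > 0))"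

text \<open>Only meaningful for linear \<open>T\<close>, otherwise the argument of \<^const>\<open>Abs_adual\<close> need not be a
  linear form.\<close>

definition Tadj :: "('u::real_vector adual \<Rightarrow> 'y::real_vector adual) \<Rightarrow> 'y \<Rightarrow> 'u adual adual" where
  "Tadj T y = Abs_adual (\<lambda>l. \<langle>y, T l\<rangle>)"

lemma app_Tadj:
  assumes "linear T"
  shows "\<langle>l, Tadj T y\<rangle> = \<langle>y, T l\<rangle>"
proof -
  have "linear (\<lambda>l. \<langle>y, T l\<rangle>)"
    using assms by (intro linearI) (simp_all add: linear_add linear_scale)
  then show ?thesis
    by (simp add: Tadj_def Abs_adual_inverse)
qed

definition H_T :: "('u::real_vector adual \<Rightarrow> 'y::real_vector adual) \<Rightarrow> bool" where
  "H_T T \<longleftrightarrow> range (Tadj T) \<subseteq> range canon \<and> {y. Tadj T y = 0} = {0}"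

text \<open>The adjoint with values in the primal space itself, which \<^const>\<open>canon\<close> identifies with a
  subspace of its bidual.\<close>

definition Tstar :: "('u::real_vector adual \<Rightarrow> 'y::real_vector adual) \<Rightarrow> 'y \<Rightarrow> 'u" where
  "Tstar T y = inv canon (Tadj T y)"

lemma app_Tstar:
  assumes "linear T" "H_T T"
  shows "\<langle>Tstar T y, l\<rangle> = \<langle>y, T l\<rangle>"
proof -
  have "canon (Tstar T y) = Tadj T y"
    using assms(2) unfolding Tstar_def H_T_def by (intro f_inv_into_f) auto
  then show ?thesis
    by (metis app_Tadj app_canon assms(1))
qed

definition Lam :: "('u::real_vector \<Rightarrow> ereal) \<Rightarrow> ('u adual \<Rightarrow> 'y::real_vector adual) \<Rightarrow> 'y \<Rightarrow> ereal" where
  "Lam \<Phi> T y = \<Phi> (Tstar T y)"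

definition L1 :: "('u::real_vector \<Rightarrow> ereal) \<Rightarrow> 'u adual set" where
  "L1 \<Phi> = top_dual (lux \<Phi>)"

definition U1 :: "('u::real_vector \<Rightarrow> ereal) \<Rightarrow> (nat \<Rightarrow> 'u) set set" where
  "U1 \<Phi> = completion (lux \<Phi>)"

definition X1 :: "('u::real_vector \<Rightarrow> ereal) \<Rightarrow> ('u adual \<Rightarrow> 'y::real_vector adual) \<Rightarrow> 'y adual set" where
  "X1 \<Phi> T = top_dual (lux (Lam \<Phi> T))"

definition Y1 :: "('u::real_vector \<Rightarrow> ereal) \<Rightarrow> ('u adual \<Rightarrow> 'y::real_vector adual) \<Rightarrow> (nat \<Rightarrow> 'y) set set" where
  "Y1 \<Phi> T = completion (lux (Lam \<Phi> T))"

definition T2star ::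
    "('u::real_vector \<Rightarrow> ereal) \<Rightarrow> ('u adual \<Rightarrow> 'y::real_vector adual) \<Rightarrow> ('y adual \<Rightarrow> real) \<Rightarrow> 'u adual \<Rightarrow> real" where
  "T2star \<Phi> T \<omega> = restrict (\<lambda>l. \<omega> (T l)) (L1 \<Phi>)"

text \<open>The restriction of \<^const>\<open>T2star\<close> to the completion \<^const>\<open>Y1\<close>, with values read in the
  completion \<^const>\<open>U1\<close>; both completions are identified with spaces of forms by \<^const>\<open>cemb\<close>.\<close>

definition T1star ::
    "('u::real_vector \<Rightarrow> ereal) \<Rightarrow> ('u adual \<Rightarrow> 'y::real_vector adual) \<Rightarrow> (nat \<Rightarrow> 'y) set \<Rightarrow> (nat \<Rightarrow> 'u) set" where
  "T1star \<Phi> T y = inv_into (U1 \<Phi>) (cemb (lux \<Phi>)) (T2star \<Phi> T (cemb (lux (Lam \<Phi> T)) y))"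

section \<open>The functions\<close>

definition Phi_star :: "('u::real_vector \<Rightarrow> ereal) \<Rightarrow> 'u adual \<Rightarrow> ereal" where
  "Phi_star \<Phi> l = (SUP u. ereal \<langle>u, l\<rangle> - \<Phi> u)"

definition Phi0 :: "('u::real_vector \<Rightarrow> ereal) \<Rightarrow> 'u \<Rightarrow> ereal" where
  "Phi0 \<Phi> u = (SUP l. ereal \<langle>u, l\<rangle> - Phi_star \<Phi> l)"

definition Phi1 :: "('u::real_vector \<Rightarrow> ereal) \<Rightarrow> (nat \<Rightarrow> 'u) set \<Rightarrow> ereal" where
  "Phi1 \<Phi> u = (SUP l\<in>L1 \<Phi>. ereal (cpair u l) - Phi_star \<Phi> l)"

definition Phi2 :: "('u::real_vector \<Rightarrow> ereal) \<Rightarrow> ('u adual \<Rightarrow> real) \<Rightarrow> ereal" where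
  "Phi2 \<Phi> \<zeta> = (SUP l\<in>L1 \<Phi>. ereal (\<zeta> l) - Phi_star \<Phi> l)"

definition Lam0 :: "('u::real_vector \<Rightarrow> ereal) \<Rightarrow> ('u adual \<Rightarrow> 'y::real_vector adual) \<Rightarrow> 'y \<Rightarrow> ereal" where
  "Lam0 \<Phi> T y = Phi0 \<Phi> (Tstar T y)"

definition Lam1 :: "('u::real_vector \<Rightarrow> ereal) \<Rightarrow> ('u adual \<Rightarrow> 'y::real_vector adual) \<Rightarrow> (nat \<Rightarrow> 'y) set \<Rightarrow> ereal" where
  "Lam1 \<Phi> T y = Phi1 \<Phi> (T1star \<Phi> T y)"

definition Lam2 :: "('u::real_vector \<Rightarrow> ereal) \<Rightarrow> ('u adual \<Rightarrow> 'y::real_vector adual) \<Rightarrow> ('y adual \<Rightarrow> real) \<Rightarrow> ereal" where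
  "Lam2 \<Phi> T \<omega> = Phi2 \<Phi> (T2star \<Phi> T \<omega>)"

definition Lam0_star :: "('u::real_vector \<Rightarrow> ereal) \<Rightarrow> ('u adual \<Rightarrow> 'y::real_vector adual) \<Rightarrow> 'y adual \<Rightarrow> ereal" where
  "Lam0_star \<Phi> T x = (SUP y. ereal \<langle>y, x\<rangle> - Lam0 \<Phi> T y)"

definition dom_Lam1 :: "('u::real_vector \<Rightarrow> ereal) \<Rightarrow> ('u adual \<Rightarrow> 'y::real_vector adual) \<Rightarrow> (nat \<Rightarrow> 'y) set set" where
  "dom_Lam1 \<Phi> T = {y \<in> Y1 \<Phi> T. Lam1 \<Phi> T y < \<infinity>}"

definition subdiff_Phi2 :: "('u::real_vector \<Rightarrow> ereal) \<Rightarrow> ('u adual \<Rightarrow> real) \<Rightarrow> 'u adual set" where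
  "subdiff_Phi2 \<Phi> \<zeta> = {l \<in> L1 \<Phi>. \<forall>\<xi>\<in>adual_on (L1 \<Phi>).
     Phi2 \<Phi> (restrict (\<lambda>m. \<zeta> m + \<xi> m) (L1 \<Phi>)) \<ge> Phi2 \<Phi> \<zeta> + ereal (\<xi> l)}"

definition diffdom_Lam0_star :: "('u::real_vector \<Rightarrow> ereal) \<Rightarrow> ('u adual \<Rightarrow> 'y::real_vector adual) \<Rightarrow> 'y adual set" where
  "diffdom_Lam0_star \<Phi> T = {x \<in> X1 \<Phi> T. \<exists>\<omega>\<in>adual_on (X1 \<Phi> T). \<forall>x'\<in>X1 \<Phi> T.
     Lam0_star \<Phi> T x' \<ge> Lam0_star \<Phi> T x + ereal (\<omega> (x' - x))}"

section \<open>The optimization problems\<close>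

definition inf_P :: "('u::real_vector \<Rightarrow> ereal) \<Rightarrow> ('u adual \<Rightarrow> 'y::real_vector adual) \<Rightarrow> 'y adual \<Rightarrow> ereal" where
  "inf_P \<Phi> T xb = (INF l\<in>{l. T l = xb}. Phi_star \<Phi> l)"

definition sol_P :: "('u::real_vector \<Rightarrow> ereal) \<Rightarrow> ('u adual \<Rightarrow> 'y::real_vector adual) \<Rightarrow> 'y adual \<Rightarrow> 'u adual set" where
  "sol_P \<Phi> T xb = {l. T l = xb \<and> Phi_star \<Phi> l = inf_P \<Phi> T xb}"

definition sup_D2 :: "('u::real_vector \<Rightarrow> ereal) \<Rightarrow> ('u adual \<Rightarrow> 'y::real_vector adual) \<Rightarrow> 'y adual \<Rightarrow> ereal" where
  "sup_D2 \<Phi> T xb = (SUP \<omega>\<in>adual_on (X1 \<Phi> T). ereal (\<omega> xb) - Lam2 \<Phi> T \<omega>)"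

definition sol_D2 :: "('u::real_vector \<Rightarrow> ereal) \<Rightarrow> ('u adual \<Rightarrow> 'y::real_vector adual) \<Rightarrow> 'y adual \<Rightarrow> ('y adual \<Rightarrow> real) set" where
  "sol_D2 \<Phi> T xb =
     {\<omega> \<in> adual_on (X1 \<Phi> T). ereal (\<omega> xb) - Lam2 \<Phi> T \<omega> = sup_D2 \<Phi> T xb}"

definition Dset :: "('u::real_vector \<Rightarrow> ereal) \<Rightarrow> ('u adual \<Rightarrow> 'y::real_vector adual) \<Rightarrow> 'y adual \<Rightarrow> 'y adual set" where
  "Dset \<Phi> T xb = {x \<in> X1 \<Phi> T. Lam0_star \<Phi> T (xb + x) \<le> Lam0_star \<Phi> T xb + 1}"

end

theory Submission
  imports Defs
begin

text \<open>
  The equality \<open>Lam0_star \<Phi> T x = min {Phi_star \<Phi> l | T l = x}\<close> carries the whole duality. Write \<open>c\<close>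
  for the left-hand side: the form \<open>Tstar T y \<mapsto> \<langle>y, x\<rangle>\<close> is at most \<open>\<Phi> + c\<close> on the range of
  \<open>Tstar T\<close>, and since \<open>0\<close> is an algebraically interior point of the domain of \<open>\<Phi>\<close>, Hahn--Banach
  extends it to a form \<open>l\<close> below \<open>\<Phi> + c\<close>; this \<open>l\<close> is a minimizer. No compactness of level sets
  is needed.

  Consequently \<open>Lam2\<close> is the conjugate of \<open>Lam0_star\<close> restricted to \<open>X1\<close>, the dual solutions are the
  subgradients of \<open>Lam0_star\<close> at \<open>xb\<close>, and the optimality conditions are equality in Fenchel's
  inequality. If a dual solution were not in the weak closure of the domain of \<open>Lam\<close>, finitely many
  elements of \<open>X1\<close> would separate it from that domain, and the biconjugate would be infinite there. Finally
  a subgradient is bounded by \<open>1\<close> on \<open>Dset\<close>, hence dominated by the gauge of \<open>Dset\<close>.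
\<close>

section \<open>Hahn--Banach for sublinear and convex functions\<close>

text \<open>Homogeneity is asked for only as an inequality at positive scalars, which passes to
  infima easily; applying it to \<open>inverse c\<close> gives the equality.\<close>

definition sublinear :: "('a::real_vector \<Rightarrow> real) \<Rightarrow> bool" where
  "sublinear p \<longleftrightarrow> p 0 = 0 \<and> (\<forall>x y. p (x + y) \<le> p x + p y) \<and> (\<forall>c>0. \<forall>x. p (c *\<^sub>R x) \<le> c * p x)"

lemma
  assumes "sublinear p"
  shows sublinear_zero: "p 0 = 0"
    and sublinear_add: "p (x + y) \<le> p x + p y"
    and sublinear_scale_le: "0 < c \<Longrightarrow> p (c *\<^sub>R x) \<le> c * p x"
  using assms by (auto simp: sublinear_def)

lemma sublinear_scale:
  assumes "sublinear p" "0 \<le> c"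
  shows "p (c *\<^sub>R x) = c * p x"
proof (cases "c = 0")
  case False
  have "p (inverse c *\<^sub>R (c *\<^sub>R x)) \<le> inverse c * p (c *\<^sub>R x)"
    using assms False by (intro sublinear_scale_le) auto
  then have "c * p x \<le> p (c *\<^sub>R x)"
    using assms False by (simp add: field_simps)
  then show ?thesis
    using sublinear_scale_le[of p c x] assms False by simp
qed (simp add: sublinear_zero[OF assms(1)])

lemma sublinear_neg:
  assumes "sublinear p"
  shows "- p (- x) \<le> p x"
  using sublinear_add[OF assms, of x "- x"] sublinear_zero[OF assms] by simp

text \<open>The minorant is the infimal convolution of \<open>p\<close> with the cone, the infimum
  of \<open>p (x + k) + r\<close>. Closure of \<open>K\<close> under sums and scaling makes it
  sublinear, the hypothesis on \<open>- r\<close> keeps it above \<open>- p (- x)\<close>, and the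
  choice \<open>x = - k\<close> yields the last claim. A ray and the graph of a linear map are the
  two cones used below.\<close>

lemma sublinear_cone_minorant:
  fixes p :: "'a::real_vector \<Rightarrow> real" and K :: "('a \<times> real) set"
  assumes p: "sublinear p" and K: "convex_cone K"
    and le: "\<And>k r. (k, r) \<in> K \<Longrightarrow> - r \<le> p k"
  obtains q where "sublinear q" "\<And>x. q x \<le> p x" "\<And>k r. (k, r) \<in> K \<Longrightarrow> q (- k) \<le> r"
proof -
  define q where "q x = (INF (k, r)\<in>K. p (x + k) + r)" for x
  have K0: "(0, 0) \<in> K"
    using K by (simp add: convex_cone_iff zero_prod_def)
  have low: "- p (- x) \<le> p (x + k) + r" if "(k, r) \<in> K" for x k r
    using sublinear_add[OF p, of "x + k" "- x"] le[OF that] by simp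
  have up: "q x \<le> p (x + k) + r" if "(k, r) \<in> K" for x k r
    using that low unfolding q_def
    by (intro cINF_lower2[where x = "(k, r)"] bdd_belowI2[where m = "- p (- x)"]) auto
  have greatest: "m \<le> q x" if "\<And>k r. (k, r) \<in> K \<Longrightarrow> m \<le> p (x + k) + r" for m x
    using K0 that unfolding q_def by (intro cINF_greatest) auto
  have add: "q (x + y) \<le> q x + q y" for x y
  proof -
    have "q (x + y) - q y \<le> p (x + k) + r" if k: "(k, r) \<in> K" for k r
    proof -
      have "q (x + y) - (p (x + k) + r) \<le> p (y + k') + r'" if k': "(k', r') \<in> K" for k' r'
      proof -
        have "(k + k', r + r') \<in> K"
          using convex_cone_add[OF K k k'] by simp
        then have "q (x + y) \<le> p ((x + k) + (y + k')) + (r + r')"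
          using up by (metis ab_semigroup_add_class.add_ac(1) add.left_commute)
        then show ?thesis
          using sublinear_add[OF p, of "x + k" "y + k'"] by linarith
      qed
      then have "q (x + y) - (p (x + k) + r) \<le> q y"
        by (rule greatest)
      then show ?thesis by linarith
    qed
    then have "q (x + y) - q y \<le> q x"
      by (rule greatest)
    then show ?thesis by linarith
  qed
  have scale: "q (c *\<^sub>R x) \<le> c * q x" if c: "0 < c" for c x
  proof -
    have "q (c *\<^sub>R x) / c \<le> p (x + k) + r" if k: "(k, r) \<in> K" for k r
    proof -
      have "(c *\<^sub>R k, c * r) \<in> K"
        using convex_cone_scaleR[OF K _ k, of c] c by simp
      then have "q (c *\<^sub>R x) \<le> p (c *\<^sub>R (x + k)) + c * r"
        using up by (metis scaleR_right_distrib)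
      also have "\<dots> \<le> c * (p (x + k) + r)"
        using sublinear_scale_le[OF p c, of "x + k"] by (simp add: algebra_simps)
      finally show ?thesis
        using c by (simp add: field_simps)
    qed
    then have "q (c *\<^sub>R x) / c \<le> q x"
      by (rule greatest)
    then show ?thesis
      using c by (simp add: field_simps)
  qed
  have le_p: "q x \<le> p x" for x
    using up[OF K0, of x] by simp
  have "0 \<le> q 0"
    by (rule greatest) (use low[of _ _ 0] sublinear_zero[OF p] in auto)
  then have "q 0 = 0"
    using le_p[of 0] sublinear_zero[OF p] by simp
  then have "sublinear q"
    using add scale by (auto simp: sublinear_def)
  moreover have "q (- k) \<le> r" if "(k, r) \<in> K" for k r
    using up[OF that, of "- k"] sublinear_zero[OF p] by simp
  ultimately show thesis
    using that le_p by blast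
qed

text \<open>For the ray \<open>K\<close> through \<open>(s, - p s)\<close> the condition
  \<open>- r \<le> p k\<close> holds with equality, so there is a sublinear \<open>q\<close> below
  \<open>p\<close> with \<open>q (- s) \<le> - p s\<close>. By minimality \<open>q = p\<close>,
  hence \<open>p\<close> is odd, and an odd sublinear function is linear.\<close>

lemma minimal_sublinear_linear:
  assumes p: "sublinear p"
    and min: "\<And>q. sublinear q \<Longrightarrow> (\<And>x. q x \<le> p x) \<Longrightarrow> q = p"
  shows "linear p"
proof -
  have odd: "p (- s) = - p s" for s
  proof -
    define K where "K = {(t *\<^sub>R s, - t * p s) | t. 0 \<le> t}"
    have "convex_cone K"
      unfolding convex_cone_iff
    proof (intro conjI ballI allI impI)
      show "0 \<in> K"
        unfolding K_def zero_prod_def by (auto intro: exI[of _ 0])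
    next
      fix x y assume "x \<in> K" "y \<in> K"
      then obtain a b where "x = (a *\<^sub>R s, - a * p s)" "y = (b *\<^sub>R s, - b * p s)" "0 \<le> a" "0 \<le> b"
        unfolding K_def by auto
      then show "x + y \<in> K"
        unfolding K_def by (auto intro!: exI[of _ "a + b"] simp: algebra_simps)
    next
      fix x and c :: real assume "x \<in> K" "0 \<le> c"
      then obtain a where "x = (a *\<^sub>R s, - a * p s)" "0 \<le> a"
        unfolding K_def by auto
      with \<open>0 \<le> c\<close> show "c *\<^sub>R x \<in> K"
        unfolding K_def by (auto intro!: exI[of _ "c * a"])
    qed
    moreover have "- r \<le> p k" if "(k, r) \<in> K" for k r
      using that sublinear_scale[OF p] unfolding K_def by auto
    ultimately obtain q where q: "sublinear q" "\<And>x. q x \<le> p x"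
      "\<And>k r. (k, r) \<in> K \<Longrightarrow> q (- k) \<le> r"
      using sublinear_cone_minorant[OF p] by blast
    have "(s, - p s) \<in> K"
      unfolding K_def by (auto intro!: exI[of _ 1])
    then have "p (- s) \<le> - p s"
      using q min by blast
    then show ?thesis
      using sublinear_neg[OF p, of "- s"] by simp
  qed
  have add: "p (x + y) = p x + p y" for x y
    using sublinear_add[OF p, of x y] sublinear_add[OF p, of "x + y" "- y"] odd[of y] by simp
  have "p (c *\<^sub>R x) = c * p x" for c x
  proof (cases "0 \<le> c")
    case False
    then have "p (c *\<^sub>R x) = - p ((- c) *\<^sub>R x)"
      using odd by (metis scaleR_minus_left minus_minus)
    then show ?thesis
      using sublinear_scale[OF p, of "- c"] False by simp
  qed (rule sublinear_scale[OF p])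
  then show ?thesis
    using add by (intro linearI) auto
qed

text \<open>Zorn's lemma in the reversed order, on the sublinear functions below \<open>p\<close>. A
  chain has its pointwise infimum as lower bound, which is finite because every member
  \<open>q\<close> satisfies \<open>- p (- x) \<le> - q (- x) \<le> q x\<close>.\<close>

lemma linear_below_sublinear:
  fixes p :: "'a::real_vector \<Rightarrow> real"
  assumes p: "sublinear p"
  obtains f where "linear f" "\<And>x. f x \<le> p x"
proof -
  define A where "A = {q. sublinear q \<and> (\<forall>x. q x \<le> p x)}"
  have "\<exists>m\<in>A. \<forall>a\<in>A. a \<le> m \<longrightarrow> a = m"
  proof (rule predicate_Zorn[where P = "\<lambda>q q'. q' \<le> q"])
    show "partial_order_on A (relation_of (\<lambda>q q'. q' \<le> q) A)"
      by (rule partial_order_on_relation_ofI) auto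
  next
    fix C assume C: "C \<in> Chains (relation_of (\<lambda>q q'. q' \<le> q) A)"
    have CA: "q \<in> A" if "q \<in> C" for q
      using C that by (auto simp: Chains_def relation_of_def)
    have chain: "q \<le> q' \<or> q' \<le> q" if "q \<in> C" "q' \<in> C" for q q'
      using C that by (auto simp: Chains_def relation_of_def)
    show "\<exists>u\<in>A. \<forall>a\<in>C. u \<le> a"
    proof (cases "C = {}")
      case True
      then show ?thesis using p by (auto simp: A_def)
    next
      case False
      define u where "u x = (INF q\<in>C. q x)" for x
      have low: "- p (- x) \<le> q x" if "q \<in> C" for q x
        using CA[OF that] sublinear_neg[of q x] by (force simp: A_def intro: order_trans[rotated])
      have up: "u x \<le> q x" if "q \<in> C" for q x
        unfolding u_def using that low by (intro cINF_lower bdd_belowI2[of _ "- p (- x)"]) auto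
      have greatest: "m \<le> u x" if "\<And>q. q \<in> C \<Longrightarrow> m \<le> q x" for m x
        unfolding u_def using False that by (intro cINF_greatest) auto
      have "u (x + y) \<le> u x + u y" for x y
      proof -
        have "u (x + y) - u y \<le> q x" if q: "q \<in> C" for q
        proof -
          have "u (x + y) - q x \<le> q' y" if q': "q' \<in> C" for q'
          proof -
            \<comment> \<open>Subadditivity of the infimum needs a single member that is small at
              both \<open>x\<close> and \<open>y\<close>; in a chain the lesser of \<open>q\<close>
              and \<open>q'\<close> serves.\<close>
            obtain m where m: "m \<in> C" "m \<le> q" "m \<le> q'"
              using chain[OF q q'] q q' by blast
            have "u (x + y) \<le> m x + m y"
              using up[OF m(1), of "x + y"] sublinear_add[of m x y] CA[OF m(1)]
              by (auto simp: A_def)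
            then show ?thesis
              using le_funD[OF m(2), of x] le_funD[OF m(3), of y] by linarith
          qed
          then have "u (x + y) - q x \<le> u y" by (rule greatest)
          then show ?thesis by linarith
        qed
        then have "u (x + y) - u y \<le> u x" by (rule greatest)
        then show ?thesis by linarith
      qed
      moreover have "u (c *\<^sub>R x) \<le> c * u x" if c: "0 < c" for c x
      proof -
        have "u (c *\<^sub>R x) / c \<le> q x" if q: "q \<in> C" for q
          using up[OF q, of "c *\<^sub>R x"] sublinear_scale_le[of q c x] CA[OF q] c
          by (auto simp: A_def field_simps intro: order_trans)
        then have "u (c *\<^sub>R x) / c \<le> u x" by (rule greatest)
        then show ?thesis using c by (simp add: field_simps)
      qed
      moreover have "u 0 = 0"
      proof -
        have "q 0 = 0" if "q \<in> C" for q
          using CA[OF that] by (auto simp: A_def sublinear_zero)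
        then have "(INF q\<in>C. q 0) = (INF q\<in>C. 0)" by (intro INF_cong) auto
        then show ?thesis using False by (simp add: u_def)
      qed
      ultimately have "sublinear u" by (auto simp: sublinear_def)
      moreover have "u x \<le> p x" for x
        using False up CA by (fastforce simp: A_def intro: order_trans)
      ultimately show ?thesis
        using up by (auto simp: A_def le_fun_def)
    qed
  qed
  then obtain m where m: "m \<in> A" "\<And>a. a \<in> A \<Longrightarrow> a \<le> m \<Longrightarrow> a = m" by blast
  have "linear m"
  proof (rule minimal_sublinear_linear)
    show "sublinear m" using m(1) by (simp add: A_def)
    fix q assume q: "sublinear q" "\<And>x. q x \<le> m x"
    then have "q \<in> A" using m(1) by (auto simp: A_def intro: order_trans)
    then show "q = m" using m(2) q by (auto simp: le_fun_def)
  qed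
  then show thesis
    using m(1) that by (auto simp: A_def)
qed

text \<open>A linear form below the minorant for the cone of all \<open>(A y, - g y)\<close>
  satisfies \<open>f (- A y) \<le> - g y\<close>, and replacing \<open>y\<close> by
  \<open>- y\<close> turns this into equality. The domination by \<open>p\<close> forces
  \<open>g\<close> to vanish on the kernel of \<open>A\<close>, so extending along \<open>A\<close>
  is consistent.\<close>

lemma sublinear_Hahn_Banach:
  fixes p :: "'a::real_vector \<Rightarrow> real" and A :: "'b::real_vector \<Rightarrow> 'a"
  assumes p: "sublinear p" and A: "linear A" and g: "linear g"
    and le: "\<And>y. g y \<le> p (A y)"
  obtains f where "linear f" "\<And>x. f x \<le> p x" "\<And>y. f (A y) = g y"
proof -
  let ?K = "range (\<lambda>y. (A y, - g y))"
  have "linear (\<lambda>y. (A y, - g y))"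
    using A g by (intro linearI) (simp_all add: linear_add linear_scale)
  then have "convex_cone ?K"
    by (intro convex_cone_linear_image conjI) (simp_all add: convex_cone_iff)
  moreover have "- r \<le> p k" if "(k, r) \<in> ?K" for k r
    using that le by auto
  ultimately obtain q where q: "sublinear q" "\<And>x. q x \<le> p x"
    "\<And>k r. (k, r) \<in> ?K \<Longrightarrow> q (- k) \<le> r"
    using sublinear_cone_minorant[OF p] by blast
  obtain f where f: "linear f" "\<And>x. f x \<le> q x"
    using linear_below_sublinear[OF q(1)] by blast
  have ge: "g y \<le> f (A y)" for y
    using q(3)[of "A y" "- g y"] f(2)[of "- A y"] linear_neg[OF f(1)] by fastforce
  have "f (A y) = g y" for y
    using ge[of y] ge[of "- y"] linear_neg[OF f(1)] linear_neg[OF g] linear_neg[OF A] by force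
  then show thesis
    using that f q(2) by (meson order_trans)
qed

text \<open>Reduction to the sublinear case through the largest positively homogeneous minorant of
  \<open>F + c\<close>, the infimum over \<open>t > 0\<close> of \<open>t * (F (u / t) + c)\<close>.
  Absorption makes it finite, and \<open>c \<ge> 0\<close>, read off at \<open>y = 0\<close>, makes
  it nonnegative. Its value at \<open>t = 1\<close> gives back the bound by
  \<open>F + c\<close>.\<close>

lemma convex_Hahn_Banach:
  fixes F :: "'a::real_vector \<Rightarrow> ereal" and A :: "'b::real_vector \<Rightarrow> 'a"
  assumes F0: "\<And>u. 0 \<le> F u" and conv: "ereal_convex F" and F00: "F 0 = 0"
    and absorb: "\<And>u. \<exists>\<alpha>>0. F (\<alpha> *\<^sub>R u) < \<infinity>"
    and A: "linear A" and g: "linear g" and le: "\<And>y. ereal (g y) \<le> F (A y) + ereal c"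
  obtains f where "linear f" "\<And>u. ereal (f u) \<le> F u + ereal c" "\<And>y. f (A y) = g y"
proof -
  have c: "0 \<le> c"
    using le[of 0] F00 linear_0[OF A] linear_0[OF g] by (simp flip: zero_ereal_def)
  \<comment> \<open>Ranging over real upper bounds \<open>a\<close> of \<open>F\<close> keeps the
    infimum real; scales at which \<open>F\<close> is infinite contribute nothing.\<close>
  define S where "S u = {t * (a + c) | t a. 0 < t \<and> F (u /\<^sub>R t) \<le> ereal a}" for u
  have SI: "t * (a + c) \<in> S u" if "0 < t" "F (u /\<^sub>R t) \<le> ereal a" for t a u
    using that unfolding S_def by blast
  define p where "p u = Inf (S u)" for u
  have low: "0 \<le> s" if "s \<in> S u" for s u
  proof -
    obtain t a where "s = t * (a + c)" "0 < t" "F (u /\<^sub>R t) \<le> ereal a"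
      using \<open>s \<in> S u\<close> by (auto simp: S_def)
    moreover from this have "0 \<le> a"
      using F0[of "u /\<^sub>R t"] by (metis ereal_less_eq(3) order_trans zero_ereal_def)
    ultimately show ?thesis using c by simp
  qed
  have up: "p u \<le> s" if "s \<in> S u" for s u
    unfolding p_def using that low by (intro cInf_lower bdd_belowI[of _ 0]) auto
  have nonempty: "S u \<noteq> {}" for u
  proof -
    obtain \<alpha> where \<alpha>: "\<alpha> > 0" "F (\<alpha> *\<^sub>R u) < \<infinity>" using absorb by blast
    then obtain a where "F (\<alpha> *\<^sub>R u) = ereal a"
      using F0[of "\<alpha> *\<^sub>R u"] by (cases "F (\<alpha> *\<^sub>R u)") auto
    then have "inverse \<alpha> * (a + c) \<in> S u"
      using \<alpha> by (intro SI) auto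
    then show ?thesis by blast
  qed
  have greatest: "m \<le> p u" if "\<And>s. s \<in> S u \<Longrightarrow> m \<le> s" for m u
    unfolding p_def using nonempty that by (intro cInf_greatest) auto
  have S_add: "r + s \<in> S (u + v)" if "r \<in> S u" "s \<in> S v" for r s u v
  proof -
    obtain t a where r: "r = t * (a + c)" "0 < t" "F (u /\<^sub>R t) \<le> ereal a"
      using \<open>r \<in> S u\<close> by (auto simp: S_def)
    obtain t' a' where s: "s = t' * (a' + c)" "0 < t'" "F (v /\<^sub>R t') \<le> ereal a'"
      using \<open>s \<in> S v\<close> by (auto simp: S_def)
    \<comment> \<open>The weights proportional to \<open>t\<close> and \<open>t'\<close> write
      \<open>(u + v) / (t + t')\<close> as a convex combination of \<open>u / t\<close> and
      \<open>v / t'\<close>.\<close>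
    define \<theta> where "\<theta> = t' / (t + t')"
    have \<theta>: "\<theta> \<in> {0<..<1}" "1 - \<theta> = t / (t + t')"
      using r s by (auto simp: \<theta>_def field_simps)
    have eq: "(u + v) /\<^sub>R (t + t') = (1 - \<theta>) *\<^sub>R (u /\<^sub>R t) + \<theta> *\<^sub>R (v /\<^sub>R t')"
    proof -
      have "(1 - \<theta>) * inverse t = inverse (t + t')" "\<theta> * inverse t' = inverse (t + t')"
        using r(2) s(2) unfolding \<theta>(2) by (simp_all add: \<theta>_def field_simps)
      then show ?thesis by (simp add: scaleR_add_right)
    qed
    have "F ((u + v) /\<^sub>R (t + t')) \<le> ereal (1 - \<theta>) * F (u /\<^sub>R t) + ereal \<theta> * F (v /\<^sub>R t')"
      unfolding eq by (rule conv[unfolded ereal_convex_def, rule_format, OF \<theta>(1)])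
    also have "\<dots> \<le> ereal (1 - \<theta>) * ereal a + ereal \<theta> * ereal a'"
      using r(3) s(3) \<theta>(1) by (intro add_mono ereal_mult_left_mono) auto
    also have "\<dots> = ereal ((t * a + t' * a') / (t + t'))"
      unfolding \<theta>(2) by (simp add: \<theta>_def add_divide_distrib)
    finally have "(t + t') * ((t * a + t' * a') / (t + t') + c) \<in> S (u + v)"
      using r(2) s(2) by (intro SI) auto
    moreover have "(t + t') * ((t * a + t' * a') / (t + t') + c) = r + s"
      using r s by (simp add: field_simps)
    ultimately show ?thesis by simp
  qed
  have S_scale: "k * s \<in> S (k *\<^sub>R u)" if k: "0 < k" and "s \<in> S u" for k s u
  proof -
    obtain t a where s: "s = t * (a + c)" "0 < t" "F (u /\<^sub>R t) \<le> ereal a"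
      using \<open>s \<in> S u\<close> by (auto simp: S_def)
    have "(k *\<^sub>R u) /\<^sub>R (k * t) = u /\<^sub>R t"
      using k by simp
    then have "F ((k *\<^sub>R u) /\<^sub>R (k * t)) \<le> ereal a"
      using s(3) by metis
    from SI[OF mult_pos_pos[OF k s(2)] this] have "k * t * (a + c) \<in> S (k *\<^sub>R u)" .
    then show ?thesis by (simp only: s mult.assoc)
  qed
  have "sublinear p"
    unfolding sublinear_def
  proof (intro conjI allI impI)
    \<comment> \<open>At the origin every \<open>t * c\<close> is admissible because
      \<open>F 0 = 0\<close>; the scale \<open>e / (c + 1)\<close> brings it below
      \<open>e\<close>.\<close>
    have "p 0 \<le> e" if "0 < e" for e
    proof -
      have "(e / (c + 1)) * (0 + c) \<in> S 0"
        using \<open>0 < e\<close> c F00 by (intro SI) (auto simp: zero_ereal_def)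
      then have "p 0 \<le> e * (c / (c + 1))"
        using up by fastforce
      also have "\<dots> \<le> e * 1"
        using \<open>0 < e\<close> c by (intro mult_left_mono) auto
      finally show ?thesis by simp
    qed
    moreover have "0 \<le> p 0" using greatest low by blast
    ultimately show "p 0 = 0" by (metis dense_ge order_antisym)
  next
    fix u v
    have "p (u + v) - p v \<le> r" if "r \<in> S u" for r
    proof -
      have "p (u + v) - r \<le> s" if "s \<in> S v" for s
        using up[OF S_add[OF \<open>r \<in> S u\<close> that]] by linarith
      then have "p (u + v) - r \<le> p v" by (rule greatest)
      then show ?thesis by linarith
    qed
    then have "p (u + v) - p v \<le> p u" by (rule greatest)
    then show "p (u + v) \<le> p u + p v" by linarith
  next
    fix k u assume "(0::real) < k"
    have "p (k *\<^sub>R u) / k \<le> s" if "s \<in> S u" for s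
      using up[OF S_scale[OF \<open>0 < k\<close> that]] \<open>0 < k\<close> by (simp add: field_simps)
    then have "p (k *\<^sub>R u) / k \<le> p u" by (rule greatest)
    then show "p (k *\<^sub>R u) \<le> k * p u" using \<open>0 < k\<close> by (simp add: field_simps)
  qed
  moreover have "g y \<le> p (A y)" for y
  proof (rule greatest)
    fix s assume "s \<in> S (A y)"
    then obtain t a where s: "s = t * (a + c)" "0 < t" "F (A y /\<^sub>R t) \<le> ereal a"
      by (auto simp: S_def)
    have "ereal (g (y /\<^sub>R t)) \<le> F (A y /\<^sub>R t) + ereal c"
      using le[of "y /\<^sub>R t"] by (simp add: linear_scale[OF A])
    also have "\<dots> \<le> ereal a + ereal c"
      using s(3) by (intro add_right_mono)
    finally show "g y \<le> s"
      using s by (simp add: linear_scale[OF g] field_simps)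
  qed
  ultimately obtain f where f: "linear f" "\<And>x. f x \<le> p x" "\<And>y. f (A y) = g y"
    using sublinear_Hahn_Banach[OF _ A g] by metis
  have "ereal (f u) \<le> F u + ereal c" for u
  proof (cases "F u")
    case (real a)
    then have "1 * (a + c) \<in> S u"
      by (intro SI) auto
    then show ?thesis
      using up f(2)[of u] real by fastforce
  qed (use F0[of u] in auto)
  then show thesis using that f by blast
qed

section \<open>Separation by finitely many forms\<close>

lemma pairing_simps [simp]:
  "\<langle>0, l\<rangle> = 0" "\<langle>u + v, l\<rangle> = \<langle>u, l\<rangle> + \<langle>v, l\<rangle>" "\<langle>- u, l\<rangle> = - \<langle>u, l\<rangle>"
  "\<langle>u - v, l\<rangle> = \<langle>u, l\<rangle> - \<langle>v, l\<rangle>" "\<langle>c *\<^sub>R u, l\<rangle> = c * \<langle>u, l\<rangle>"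
  using linear_app[of l] by (simp_all add: linear_0 linear_add linear_neg linear_diff linear_scale)

lemma app_sum: "\<langle>v, \<Sum>i\<in>I. a i *\<^sub>R f i\<rangle> = (\<Sum>i\<in>I. a i * \<langle>v, f i\<rangle>)"
  by (induction I rule: infinite_finite_induct) auto

text \<open>The coefficients are \<open>z - p\<close>, where \<open>p\<close> is the point nearest to \<open>z\<close> of the closure of the
  image of \<open>C\<close> in the coordinates \<open>I\<close>. A minimizing sequence is Cauchy by the parallelogram law.\<close>

lemma finite_separation:
  fixes I :: "'v::real_vector adual set" and C :: "'v set" and z :: "'v adual \<Rightarrow> real"
  assumes I: "finite I" and C: "convex C" "C \<noteq> {}" and e: "0 < e"
    and far: "\<And>c. c \<in> C \<Longrightarrow> \<exists>i\<in>I. e \<le> \<bar>z i - \<langle>c, i\<rangle>\<bar>"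
  obtains a \<delta> where "0 < \<delta>" "\<And>c. c \<in> C \<Longrightarrow> (\<Sum>i\<in>I. a i * \<langle>c, i\<rangle>) + \<delta> \<le> (\<Sum>i\<in>I. a i * z i)"
proof -
  define N where "N c = (\<Sum>i\<in>I. (z i - \<langle>c, i\<rangle>)\<^sup>2)" for c
  define d where "d = (INF c\<in>C. N c)"
  have N_ge: "e\<^sup>2 \<le> N c" if c: "c \<in> C" for c
  proof -
    obtain i where i: "i \<in> I" "e \<le> \<bar>z i - \<langle>c, i\<rangle>\<bar>" using far[OF c] by blast
    then have "e\<^sup>2 \<le> (z i - \<langle>c, i\<rangle>)\<^sup>2"
      using e by (metis abs_le_square_iff abs_of_pos)
    also have "\<dots> \<le> N c"
      unfolding N_def using I i by (intro member_le_sum) auto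
    finally show ?thesis .
  qed
  have d_le: "d \<le> N c" if "c \<in> C" for c
    unfolding d_def using that N_ge by (intro cINF_lower bdd_belowI2) auto
  have d_pos: "0 < d"
  proof -
    have "e\<^sup>2 \<le> d" unfolding d_def using C N_ge by (intro cINF_greatest) auto
    then show ?thesis using zero_less_power[OF e, of 2] by linarith
  qed
  have "\<exists>c\<in>C. N c < d + 1 / real (Suc n)" for n
  proof (rule ccontr)
    assume "\<not> ?thesis"
    then have "d + 1 / real (Suc n) \<le> d"
      unfolding d_def using C by (intro cINF_greatest) (auto simp: not_less)
    then show False by simp
  qed
  then obtain s where s: "\<And>n. s n \<in> C" "\<And>n. N (s n) < d + 1 / real (Suc n)"
    by metis
  have diff_le: "(\<langle>s n, i\<rangle> - \<langle>s m, i\<rangle>)\<^sup>2 \<le> 2 * (1 / real (Suc n)) + 2 * (1 / real (Suc m))"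
    if i: "i \<in> I" for i n m
  proof -
    let ?h = "(1/2) *\<^sub>R s n + (1/2) *\<^sub>R s m"
    have "?h \<in> C"
      using C(1) s(1) by (intro convexD) auto
    then have "d \<le> N ?h" by (rule d_le)
    moreover have "(\<Sum>i\<in>I. (\<langle>s n, i\<rangle> - \<langle>s m, i\<rangle>)\<^sup>2) = 2 * N (s n) + 2 * N (s m) - 4 * N ?h"
      unfolding N_def sum_distrib_left sum.distrib[symmetric] sum_subtractf[symmetric]
      by (intro sum.cong refl) (simp add: power2_eq_square algebra_simps)
    moreover have "(\<langle>s n, i\<rangle> - \<langle>s m, i\<rangle>)\<^sup>2 \<le> (\<Sum>i\<in>I. (\<langle>s n, i\<rangle> - \<langle>s m, i\<rangle>)\<^sup>2)"
      using I i by (intro member_le_sum) auto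
    ultimately show ?thesis
      using s(2)[of n] s(2)[of m] by argo
  qed
  have "convergent (\<lambda>n. \<langle>s n, i\<rangle>)" if i: "i \<in> I" for i
  proof (rule real_Cauchy_convergent, rule metric_CauchyI)
    fix r :: real assume r: "0 < r"
    obtain k where k: "1 / real (Suc k) < r\<^sup>2 / 4"
      using reals_Archimedean[of "r\<^sup>2 / 4"] r by (auto simp: inverse_eq_divide)
    have "dist \<langle>s m, i\<rangle> \<langle>s n, i\<rangle> < r" if "k \<le> m" "k \<le> n" for m n
    proof -
      have "1 / real (Suc m) \<le> 1 / real (Suc k)" "1 / real (Suc n) \<le> 1 / real (Suc k)"
        using that by (auto simp: field_simps)
      then have "(\<langle>s m, i\<rangle> - \<langle>s n, i\<rangle>)\<^sup>2 < r\<^sup>2"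
        using diff_le[OF i, of m n] k by argo
      then show ?thesis
        using r power2_less_imp_less[of "\<bar>\<langle>s m, i\<rangle> - \<langle>s n, i\<rangle>\<bar>" r] by (simp add: dist_real_def)
    qed
    then show "\<exists>M. \<forall>m\<ge>M. \<forall>n\<ge>M. dist \<langle>s m, i\<rangle> \<langle>s n, i\<rangle> < r" by blast
  qed
  then obtain p where p: "\<And>i. i \<in> I \<Longrightarrow> (\<lambda>n. \<langle>s n, i\<rangle>) \<longlonglongrightarrow> p i"
    unfolding convergent_def by metis
  have N_lim: "(\<Sum>i\<in>I. (z i - p i)\<^sup>2) = d"
  proof (rule LIMSEQ_unique)
    show "(\<lambda>n. N (s n)) \<longlonglongrightarrow> (\<Sum>i\<in>I. (z i - p i)\<^sup>2)"
      unfolding N_def by (intro tendsto_intros p)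
    have "(\<lambda>n. d + 1 / real (Suc n)) \<longlonglongrightarrow> d + 0"
      by (intro tendsto_intros LIMSEQ_Suc[OF lim_1_over_n])
    then have up: "(\<lambda>n. d + 1 / real (Suc n)) \<longlonglongrightarrow> d" by simp
    show "(\<lambda>n. N (s n)) \<longlonglongrightarrow> d"
      by (rule tendsto_sandwich[OF _ _ tendsto_const up])
        (use s d_le in \<open>auto intro!: always_eventually less_imp_le simp del: of_nat_Suc\<close>)
  qed
  have obtuse: "(\<Sum>i\<in>I. (z i - p i) * (\<langle>c, i\<rangle> - p i)) \<le> 0" if c: "c \<in> C" for c
  proof -
    let ?M = "\<Sum>i\<in>I. (\<langle>c, i\<rangle> - p i)\<^sup>2"
    \<comment> \<open>The limit \<open>p\<close> need not be the image of a point of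
      \<open>C\<close>, so the segment towards \<open>c\<close> starts from \<open>s n\<close> and
      the comparison with \<open>d\<close> passes to the limit. After division by \<open>t\<close>
      the quadratic term vanishes as \<open>t\<close> tends to 0.\<close>
    have key: "2 * (\<Sum>i\<in>I. (z i - p i) * (\<langle>c, i\<rangle> - p i)) \<le> t * ?M" if t: "0 < t" "t < 1" for t
    proof -
      let ?c = "\<lambda>n. (1 - t) *\<^sub>R s n + t *\<^sub>R c"
      have "?c n \<in> C" for n
        using C(1) s(1) c t by (intro convexD) auto
      then have ge: "d \<le> N (?c n)" for n
        by (rule d_le)
      have "(\<lambda>n. N (?c n)) \<longlonglongrightarrow> (\<Sum>i\<in>I. (z i - ((1 - t) * p i + t * \<langle>c, i\<rangle>))\<^sup>2)"
        unfolding N_def pairing_simps by (intro tendsto_intros p)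
      then have "d \<le> (\<Sum>i\<in>I. (z i - ((1 - t) * p i + t * \<langle>c, i\<rangle>))\<^sup>2)"
        by (rule LIMSEQ_le_const) (use ge in auto)
      also have "\<dots> = (\<Sum>i\<in>I. (z i - p i)\<^sup>2) - 2 * t * (\<Sum>i\<in>I. (z i - p i) * (\<langle>c, i\<rangle> - p i)) + t\<^sup>2 * ?M"
        unfolding sum_distrib_left sum.distrib[symmetric] sum_subtractf[symmetric]
        by (intro sum.cong refl) (simp add: power2_eq_square algebra_simps)
      finally have "t * (2 * (\<Sum>i\<in>I. (z i - p i) * (\<langle>c, i\<rangle> - p i))) \<le> t * (t * ?M)"
        using N_lim by (simp add: power2_eq_square mult.assoc mult.left_commute)
      then show ?thesis using t by simp
    qed
    have "((\<lambda>t. t * ?M) \<longlongrightarrow> 0 * ?M) (at_right 0)"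
      by (intro tendsto_intros)
    moreover have "eventually (\<lambda>t. 2 * (\<Sum>i\<in>I. (z i - p i) * (\<langle>c, i\<rangle> - p i)) \<le> t * ?M) (at_right 0)"
      using eventually_at_right_real[of 0 1] by (rule eventually_mono) (auto intro!: key)
    ultimately have "2 * (\<Sum>i\<in>I. (z i - p i) * (\<langle>c, i\<rangle> - p i)) \<le> 0 * ?M"
      by (intro tendsto_lowerbound) auto
    then show ?thesis by simp
  qed
  show thesis
  \<comment> \<open>The gap is the squared distance \<open>d\<close> itself: pairing
    \<open>z - p\<close> with \<open>z - c\<close> gives \<open>d\<close> minus the nonpositive term
    of \<open>obtuse\<close>.\<close>
  proof (rule that[of d "\<lambda>i. z i - p i", OF d_pos])
    fix c assume c: "c \<in> C"
    have "(\<Sum>i\<in>I. (z i - p i) * z i) - (\<Sum>i\<in>I. (z i - p i) * \<langle>c, i\<rangle>)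
        = (\<Sum>i\<in>I. (z i - p i)\<^sup>2) - (\<Sum>i\<in>I. (z i - p i) * (\<langle>c, i\<rangle> - p i))"
      unfolding sum_subtractf[symmetric]
      by (intro sum.cong refl) (simp add: power2_eq_square algebra_simps)
    then show "(\<Sum>i\<in>I. (z i - p i) * \<langle>c, i\<rangle>) + d \<le> (\<Sum>i\<in>I. (z i - p i) * z i)"
      using N_lim obtuse[OF c] by linarith
  qed
qed

section \<open>Algebraic duals of subspaces and their weak topology\<close>

lemma adual_on_add: "\<omega> \<in> adual_on S \<Longrightarrow> x \<in> S \<Longrightarrow> y \<in> S \<Longrightarrow> \<omega> (x + y) = \<omega> x + \<omega> y"
  and adual_on_scale: "\<omega> \<in> adual_on S \<Longrightarrow> x \<in> S \<Longrightarrow> \<omega> (c *\<^sub>R x) = c * \<omega> x"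
  by (auto simp: adual_on_def)

lemma adual_on_sum:
  assumes "\<omega> \<in> adual_on S" "subspace S" "I \<subseteq> S"
  shows "\<omega> (\<Sum>i\<in>I. a i *\<^sub>R i) = (\<Sum>i\<in>I. a i * \<omega> i)"
  using assms(3)
proof (induction I rule: infinite_finite_induct)
  case (insert i I)
  then have "(\<Sum>i\<in>I. a i *\<^sub>R i) \<in> S"
    using assms(2) by (intro subspace_sum subspace_scale) auto
  then show ?case
    using insert assms by (simp add: adual_on_add adual_on_scale subspace_scale)
qed (use adual_on_scale[OF assms(1) subspace_0[OF assms(2)], of 0] in auto)

lemma adual_on_diff:
  assumes "\<omega> \<in> adual_on S" "subspace S" "x \<in> S" "y \<in> S"
  shows "\<omega> (x - y) = \<omega> x - \<omega> y"
  using adual_on_add[OF assms(1,3), of "(-1) *\<^sub>R y"] adual_on_scale[OF assms(1,4), of "-1"]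
    subspace_scale[OF assms(2,4), of "-1"] by simp

lemma restrict_adual_onI:
  assumes "subspace S" "\<And>x y. x \<in> S \<Longrightarrow> y \<in> S \<Longrightarrow> f (x + y) = f x + f y"
    "\<And>c x. x \<in> S \<Longrightarrow> f (c *\<^sub>R x) = c * f x"
  shows "restrict f S \<in> adual_on S"
  using assms by (auto simp: adual_on_def subspace_add subspace_scale)

text \<open>By induction on the generation of the open set: a subbasic set needs one test point, and
  an intersection takes the union of the test sets and the smaller radius.\<close>

lemma weak_top_nbhd:
  assumes "openin (weak_top S) W" "\<omega> \<in> W"
  shows "\<exists>I e. finite I \<and> I \<subseteq> S \<and> 0 < e \<and>
    (\<forall>\<omega>'\<in>adual_on S. (\<forall>i\<in>I. \<bar>\<omega> i - \<omega>' i\<bar> < e) \<longrightarrow> \<omega>' \<in> W)"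
proof -
  have "generate_topology_on {{\<omega> \<in> adual_on S. \<omega> x \<in> V} | x V. x \<in> S \<and> open V} W"
    using assms(1) unfolding weak_top_def by (rule openin_topology_generated_by)
  then show ?thesis
    using assms(2)
  proof (induction rule: generate_topology_on.induct)
    case (Int a b)
    then obtain I e where "finite I" "I \<subseteq> S" "0 < e"
      "\<forall>\<omega>'\<in>adual_on S. (\<forall>i\<in>I. \<bar>\<omega> i - \<omega>' i\<bar> < e) \<longrightarrow> \<omega>' \<in> a"
      by auto
    moreover from Int obtain J r where "finite J" "J \<subseteq> S" "0 < r"
      "\<forall>\<omega>'\<in>adual_on S. (\<forall>i\<in>J. \<bar>\<omega> i - \<omega>' i\<bar> < r) \<longrightarrow> \<omega>' \<in> b"
      by auto
    ultimately show ?case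
      by (intro exI[of _ "I \<union> J"] exI[of _ "min e r"]) auto
  next
    case (UN K)
    then obtain k where "k \<in> K" "\<omega> \<in> k" by blast
    with UN show ?case by (meson UnionI)
  next
    case (Basis s)
    then obtain x V where x: "x \<in> S" "open V" "s = {\<omega> \<in> adual_on S. \<omega> x \<in> V}" by blast
    then obtain e where "0 < e" "\<And>y. dist y (\<omega> x) < e \<Longrightarrow> y \<in> V"
      using Basis by (auto simp: open_dist)
    then show ?case
      using x by (intro exI[of _ "{x}"] exI[of _ e]) (auto simp: dist_real_def abs_minus_commute)
  qed simp
qed

lemma topspace_weak_top:
  assumes "subspace S"
  shows "topspace (weak_top S) = adual_on S"
proof -
  have "\<omega> \<in> topspace (weak_top S)" if "\<omega> \<in> adual_on S" for \<omega>
    using that subspace_0[OF assms] open_UNIV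
    by (auto simp: weak_top_def)
  then show ?thesis
    by (auto simp: weak_top_def)
qed

lemma weak_top_closureI:
  assumes "subspace S" "\<omega> \<in> adual_on S"
    and "\<And>I e. finite I \<Longrightarrow> I \<subseteq> S \<Longrightarrow> 0 < e \<Longrightarrow>
      \<exists>\<omega>'\<in>A. \<omega>' \<in> adual_on S \<and> (\<forall>i\<in>I. \<bar>\<omega> i - \<omega>' i\<bar> < e)"
  shows "\<omega> \<in> weak_top S closure_of A"
  unfolding in_closure_of topspace_weak_top[OF assms(1)]
  using assms(2,3) weak_top_nbhd by metis

text \<open>A point where the conjugate, over \<open>S\<close>, of the conjugate of \<open>f\<close> is finite can be approximated
  from \<open>edom f\<close>: a separating form \<open>l\<close> would make the biconjugate infinite along \<open>t *\<^sub>R l\<close>.\<close>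

lemma biconjugate_dom_approx:
  fixes f :: "'v::real_vector \<Rightarrow> ereal"
  assumes f: "\<And>u. 0 \<le> f u" "ereal_convex f" "edom f \<noteq> {}"
    and S: "subspace S" and \<omega>: "\<omega> \<in> adual_on S"
    and bound: "\<And>l. l \<in> S \<Longrightarrow> ereal (\<omega> l) \<le> Phi_star f l + ereal M"
    and I: "finite I" "I \<subseteq> S" and e: "0 < e"
  shows "\<exists>u\<in>edom f. \<forall>i\<in>I. \<bar>\<omega> i - \<langle>u, i\<rangle>\<bar> < e"
proof (rule ccontr)
  assume "\<not> ?thesis"
  then have far: "\<exists>i\<in>I. e \<le> \<bar>\<omega> i - \<langle>u, i\<rangle>\<bar>" if "u \<in> edom f" for u
    using that by (auto simp: not_less)
  have "convex (edom f)"
  proof (rule convexI)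
    fix u v and a b :: real assume uv: "u \<in> edom f" "v \<in> edom f" and ab: "0 \<le> a" "0 \<le> b" "a + b = 1"
    show "a *\<^sub>R u + b *\<^sub>R v \<in> edom f"
    proof (cases "b \<in> {0<..<1}")
      case True
      then have "f (a *\<^sub>R u + b *\<^sub>R v) \<le> ereal a * f u + ereal b * f v"
        using f(2) ab by (auto simp: ereal_convex_def eq_diff_eq[symmetric])
      also have "\<dots> < \<infinity>"
        using uv f(1)[of u] f(1)[of v] by (cases "f u"; cases "f v") (auto simp: edom_def)
      finally show ?thesis by (simp add: edom_def)
    next
      case False
      then have "b = 0 \<and> a = 1 \<or> b = 1 \<and> a = 0" using ab by auto
      then show ?thesis using uv by auto
    qed
  qed
  then obtain a \<delta> where \<delta>: "0 < \<delta>"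
    and sep: "\<And>u. u \<in> edom f \<Longrightarrow> (\<Sum>i\<in>I. a i * \<langle>u, i\<rangle>) + \<delta> \<le> (\<Sum>i\<in>I. a i * \<omega> i)"
    using finite_separation[OF I(1) _ f(3) e far] by metis
  define l where "l = (\<Sum>i\<in>I. a i *\<^sub>R i)"
  have l: "l \<in> S"
    unfolding l_def using S I by (intro subspace_sum subspace_scale) auto
  have \<omega>l: "\<omega> l = (\<Sum>i\<in>I. a i * \<omega> i)"
    unfolding l_def by (rule adual_on_sum[OF \<omega> S I(2)])
  \<comment> \<open>As \<open>f\<close> is nonnegative, the separation bounds
    \<open>Phi_star f (t *\<^sub>R l)\<close> by \<open>t * (\<omega> l - \<delta>)\<close>.
    Comparison with \<open>bound\<close> leaves \<open>t * \<delta> \<le> M\<close> for every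
    positive \<open>t\<close>, which is absurd.\<close>
  have *: "t * \<delta> \<le> M" if t: "0 < t" for t
  proof -
    have "Phi_star f (t *\<^sub>R l) \<le> ereal (t * (\<omega> l - \<delta>))"
      unfolding Phi_star_def
    proof (rule SUP_least)
      fix u
      show "ereal \<langle>u, t *\<^sub>R l\<rangle> - f u \<le> ereal (t * (\<omega> l - \<delta>))"
      proof (cases "f u")
        case (real r)
        then have "0 \<le> r" "u \<in> edom f" using f(1)[of u] by (auto simp: edom_def)
        then have "\<langle>u, l\<rangle> \<le> \<omega> l - \<delta>"
          using sep[of u] unfolding \<omega>l by (simp add: l_def app_sum)
        then have "t * \<langle>u, l\<rangle> \<le> t * (\<omega> l - \<delta>)" using t by simp
        then show ?thesis using real \<open>0 \<le> r\<close> by simp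
      qed (use f(1)[of u] in auto)
    qed
    moreover have "ereal (t * \<omega> l) \<le> Phi_star f (t *\<^sub>R l) + ereal M"
      using bound[of "t *\<^sub>R l"] adual_on_scale[OF \<omega> l] subspace_scale[OF S l] by simp
    ultimately have "ereal (t * \<omega> l) \<le> ereal (t * (\<omega> l - \<delta>)) + ereal M"
      by (meson add_right_mono order_trans)
    then show ?thesis by (simp add: algebra_simps)
  qed
  have "(\<bar>M\<bar> + 1) / \<delta> * \<delta> \<le> M"
    using \<delta> by (intro *) auto
  then show False using \<delta> by auto
qed

section \<open>Topological dual and completion\<close>

text \<open>The norms needed are values of \<open>lux\<close> and vary with \<Phi> and
  \<open>T\<close>, so they are carried as functions; nonnegativity and symmetry follow from the
  three axioms.\<close>

locale norm_fun =
  fixes nrm :: "'a::real_vector \<Rightarrow> real"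
  assumes nrm_eq_0D: "nrm u = 0 \<Longrightarrow> u = 0"
    and nrm_triangle: "nrm (u + v) \<le> nrm u + nrm v"
    and nrm_scale: "nrm (c *\<^sub>R u) = \<bar>c\<bar> * nrm u"
begin

lemma nrm_0 [simp]: "nrm 0 = 0"
  using nrm_scale[of 0 0] by simp

lemma nrm_minus: "nrm (- u) = nrm u"
  using nrm_scale[of "-1" u] by simp

lemma nrm_nonneg: "0 \<le> nrm u"
  using nrm_triangle[of u "- u"] by (simp add: nrm_minus)

sublocale Metric_space UNIV "ndist nrm"
proof
  show "nrm (u - v) = nrm (v - u)" for u v
    using nrm_minus[of "u - v"] by simp
  show "nrm (u - w) \<le> nrm (u - v) + nrm (v - w)" for u v w
    using nrm_triangle[of "u - v" "v - w"] by simp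
  show "(nrm (u - v) = 0) = (u = v)" for u v
    using nrm_eq_0D[of "u - v"] by auto
qed (rule nrm_nonneg)

lemma top_dual_iff: "l \<in> top_dual nrm \<longleftrightarrow> (\<exists>C. \<forall>u. \<bar>\<langle>u, l\<rangle>\<bar> \<le> C * nrm u)"
proof
  assume "l \<in> top_dual nrm"
  then have cont: "continuous_map mtopology euclideanreal (app l)"
    by (simp add: top_dual_def)
  have "openin euclideanreal {-1<..<1}" "\<langle>0, l\<rangle> \<in> {-1<..<1::real}"
    by auto
  then obtain r where r: "r > 0" "\<And>u. nrm (0 - u) < r \<Longrightarrow> \<langle>u, l\<rangle> \<in> {-1<..<1}"
    using cont unfolding continuous_map_from_metric by (metis UNIV_I)
  have "\<bar>\<langle>u, l\<rangle>\<bar> \<le> (2 / r) * nrm u" for u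
  proof (cases "u = 0")
    case False
    then have pos: "0 < nrm u"
      using nrm_eq_0D nrm_nonneg by (metis less_eq_real_def)
    \<comment> \<open>This factor gives \<open>k *\<^sub>R u\<close> the norm \<open>r / 2\<close>,
      strictly inside the ball supplied by continuity at 0.\<close>
    define k where "k = r / (2 * nrm u)"
    have k: "0 < k" using r pos by (simp add: k_def)
    have "nrm (0 - k *\<^sub>R u) < r"
      using r(1) k pos by (simp add: nrm_minus nrm_scale) (simp add: k_def)
    then have "\<langle>k *\<^sub>R u, l\<rangle> \<in> {-1<..<1}" by (rule r(2))
    then have "k * \<bar>\<langle>u, l\<rangle>\<bar> \<le> 1"
      using k by (cases "0 \<le> \<langle>u, l\<rangle>") simp_all
    then show ?thesis
      using r(1) pos by (simp add: k_def field_simps)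
  qed simp
  then show "\<exists>C. \<forall>u. \<bar>\<langle>u, l\<rangle>\<bar> \<le> C * nrm u" by blast
next
  assume "\<exists>C. \<forall>u. \<bar>\<langle>u, l\<rangle>\<bar> \<le> C * nrm u"
  then obtain C where C: "\<And>u. \<bar>\<langle>u, l\<rangle>\<bar> \<le> C * nrm u" by blast
  have "\<exists>\<delta>>0. \<forall>v. nrm (u - v) < \<delta> \<longrightarrow> dist \<langle>u, l\<rangle> \<langle>v, l\<rangle> < e" if e: "e > 0" for u e
  proof (intro exI conjI allI impI)
    \<comment> \<open>The constant \<open>C\<close> may be 0 or negative;
      \<open>\<bar>C\<bar> + 1\<close> is a positive Lipschitz constant.\<close>
    show "0 < e / (\<bar>C\<bar> + 1)" using e by simp
    fix v assume v: "nrm (u - v) < e / (\<bar>C\<bar> + 1)"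
    have "\<bar>\<langle>u - v, l\<rangle>\<bar> \<le> (\<bar>C\<bar> + 1) * nrm (u - v)"
      by (rule order_trans[OF C]) (intro mult_right_mono nrm_nonneg, simp)
    also have "\<dots> < e" using v by (simp add: field_simps)
    finally show "dist \<langle>u, l\<rangle> \<langle>v, l\<rangle> < e" by (simp add: dist_real_def)
  qed
  then have "continuous_map mtopology Met_TC.mtopology (app l)"
    by (subst metric_continuous_map[OF Met_TC.Metric_space_axioms]) auto
  then show "l \<in> top_dual nrm"
    by (simp add: top_dual_def)
qed

lemma subspace_top_dual: "subspace (top_dual nrm)"
proof (rule subspaceI)
  show "0 \<in> top_dual nrm"
    by (auto simp: top_dual_iff intro!: exI[of _ 0])
next
  fix l m assume "l \<in> top_dual nrm" "m \<in> top_dual nrm"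
  then obtain C D where CD: "\<And>u. \<bar>\<langle>u, l\<rangle>\<bar> \<le> C * nrm u" "\<And>u. \<bar>\<langle>u, m\<rangle>\<bar> \<le> D * nrm u"
    by (auto simp: top_dual_iff)
  then have "\<bar>\<langle>u, l + m\<rangle>\<bar> \<le> (C + D) * nrm u" for u
    unfolding app_simps distrib_right by (intro order_trans[OF abs_triangle_ineq add_mono] CD)
  then show "l + m \<in> top_dual nrm" by (auto simp: top_dual_iff)
next
  fix c l assume "l \<in> top_dual nrm"
  then obtain C where C: "\<And>u. \<bar>\<langle>u, l\<rangle>\<bar> \<le> C * nrm u"
    by (auto simp: top_dual_iff)
  have "\<bar>\<langle>u, c *\<^sub>R l\<rangle>\<bar> \<le> (\<bar>c\<bar> * C) * nrm u" for u
    using mult_left_mono[OF C[of u], of "\<bar>c\<bar>"] by (simp add: abs_mult mult.assoc)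
  then show "c *\<^sub>R l \<in> top_dual nrm" by (auto simp: top_dual_iff)
qed

text \<open>The image of \<open>u\<close> in the completion. Approximants of this form suffice for
  the weak closures below.\<close>

definition const_class :: "'a \<Rightarrow> (nat \<Rightarrow> 'a) set" where
  "const_class u = cauchy_equiv nrm `` {\<lambda>_. u}"

lemma const_class_completion: "const_class u \<in> completion nrm"
  unfolding const_class_def completion_def by (intro quotientI) simp

text \<open>All representatives converge to \<open>u\<close> in norm, so a bounded form has the same
  limit along each of them; the constant sequence makes that limit unique.\<close>

lemma cpair_const_class:
  assumes "l \<in> top_dual nrm"
  shows "cpair (const_class u) l = \<langle>u, l\<rangle>"
  unfolding cpair_def
proof (rule the_equality)
  show "\<forall>s\<in>const_class u. (\<lambda>n. \<langle>s n, l\<rangle>) \<longlonglongrightarrow> \<langle>u, l\<rangle>"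
  proof
    fix s assume "s \<in> const_class u"
    then have lim: "(\<lambda>n. nrm (u - s n)) \<longlonglongrightarrow> 0"
      by (simp add: const_class_def cauchy_equiv_def)
    obtain C where C: "\<And>u. \<bar>\<langle>u, l\<rangle>\<bar> \<le> C * nrm u"
      using assms by (auto simp: top_dual_iff)
    have "(\<lambda>n. \<langle>s n, l\<rangle> - \<langle>u, l\<rangle>) \<longlonglongrightarrow> 0"
    proof (rule Lim_null_comparison)
      have "\<bar>\<langle>s n, l\<rangle> - \<langle>u, l\<rangle>\<bar> \<le> C * nrm (u - s n)" for n
        using C[of "u - s n"] by (simp add: abs_minus_commute)
      then show "\<forall>\<^sub>F n in sequentially. norm (\<langle>s n, l\<rangle> - \<langle>u, l\<rangle>) \<le> C * nrm (u - s n)"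
        by simp
      show "(\<lambda>n. C * nrm (u - s n)) \<longlonglongrightarrow> 0"
        using tendsto_mult_left[OF lim, of C] by simp
    qed
    then show "(\<lambda>n. \<langle>s n, l\<rangle>) \<longlonglongrightarrow> \<langle>u, l\<rangle>"
      by (simp add: LIM_zero_iff)
  qed
  fix r assume "\<forall>s\<in>const_class u. (\<lambda>n. \<langle>s n, l\<rangle>) \<longlonglongrightarrow> r"
  moreover have "(\<lambda>_. u) \<in> const_class u"
    by (simp add: const_class_def cauchy_equiv_def)
  ultimately have "(\<lambda>n::nat. \<langle>u, l\<rangle>) \<longlonglongrightarrow> r"
    by (rule bspec)
  then show "r = \<langle>u, l\<rangle>"
    by (simp add: LIMSEQ_const_iff)
qed

lemma cemb_const_class: "cemb nrm (const_class u) = (\<lambda>l\<in>top_dual nrm. \<langle>u, l\<rangle>)"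
  unfolding cemb_def by (rule restrict_ext) (rule cpair_const_class)

end

section \<open>Luxemburg norms and conjugates of functions satisfying \<open>H_Phi\<close>\<close>

lemma ereal_convex_sym_max:
  assumes "ereal_convex F"
  shows "ereal_convex (sym_max F)"
  unfolding ereal_convex_def
proof (intro allI ballI)
  fix u v and t :: real assume t: "t \<in> {0<..<1}"
  have le: "F ((1 - t) *\<^sub>R u' + t *\<^sub>R v') \<le> ereal (1 - t) * sym_max F u + ereal t * sym_max F v"
    if "F u' \<le> sym_max F u" "F v' \<le> sym_max F v" for u' v'
  proof -
    have "F ((1 - t) *\<^sub>R u' + t *\<^sub>R v') \<le> ereal (1 - t) * F u' + ereal t * F v'"
      using assms t by (auto simp: ereal_convex_def)
    also have "\<dots> \<le> ereal (1 - t) * sym_max F u + ereal t * sym_max F v"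
      using that t by (intro add_mono ereal_mult_left_mono) auto
    finally show ?thesis .
  qed
  have "- ((1 - t) *\<^sub>R u + t *\<^sub>R v) = (1 - t) *\<^sub>R (- u) + t *\<^sub>R (- v)" by simp
  then show "sym_max F ((1 - t) *\<^sub>R u + t *\<^sub>R v) \<le> ereal (1 - t) * sym_max F u + ereal t * sym_max F v"
    using le[of u v] le[of "- u" "- v"] by (simp add: sym_max_def)
qed

lemma ereal_convex_scale_le:
  assumes "ereal_convex F" "F 0 = 0" "\<And>u. 0 \<le> F u" "0 < t" "t \<le> 1"
  shows "F (t *\<^sub>R u) \<le> ereal t * F u"
proof (cases "t = 1")
  case False
  then have "t \<in> {0<..<1}" using assms by auto
  with assms(1) have "F ((1 - t) *\<^sub>R 0 + t *\<^sub>R u) \<le> ereal (1 - t) * F 0 + ereal t * F u"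
    unfolding ereal_convex_def by blast
  then show ?thesis using assms(2) by simp
qed simp

context
  fixes F :: "'a::real_vector \<Rightarrow> ereal"
  assumes H: "H_Phi F"
begin

lemma H_Phi_nonneg: "0 \<le> F u" and H_Phi_zero: "F 0 = 0" and H_Phi_convex: "ereal_convex F"
  using H by (auto simp: H_Phi_def)

private lemma sym_max_nonneg: "0 \<le> sym_max F u"
  using H_Phi_nonneg by (simp add: sym_max_def le_max_iff_disj)

private lemma sym_max_zero: "sym_max F 0 = 0"
  by (simp add: sym_max_def H_Phi_zero)

private lemma sym_max_minus: "sym_max F (- u) = sym_max F u"
  by (simp add: sym_max_def max.commute)

private lemma sym_max_scale_le: "0 < t \<Longrightarrow> t \<le> 1 \<Longrightarrow> sym_max F (t *\<^sub>R u) \<le> ereal t * sym_max F u"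
  by (intro ereal_convex_scale_le ereal_convex_sym_max H_Phi_convex sym_max_nonneg sym_max_zero)

private definition adm :: "'a \<Rightarrow> real set" where
  "adm u = {\<alpha>. 0 < \<alpha> \<and> sym_max F (u /\<^sub>R \<alpha>) \<le> 1}"

private lemma lux_le: "\<alpha> \<in> adm u \<Longrightarrow> lux F u \<le> \<alpha>"
  unfolding lux_def adm_def[symmetric] by (intro cInf_lower bdd_belowI[of _ 0]) (auto simp: adm_def)

text \<open>Guards \<open>lux\<close> against an infimum over the empty set. Finiteness is given
  separately along \<open>u\<close> and \<open>- u\<close>; convexity carries both to the common
  scale \<open>min a b\<close>, and the further factor \<open>1 / (M + 1)\<close> pushes the value
  below 1.\<close>

private lemma adm_nonempty: "adm u \<noteq> {}"
proof -
  have fin: "\<exists>\<alpha>>0. F (\<alpha> *\<^sub>R v) < \<infinity>" for v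
    using H unfolding H_Phi_def by blast
  obtain a b where a: "0 < a" "F (a *\<^sub>R u) < \<infinity>" and b: "0 < b" "F (b *\<^sub>R (- u)) < \<infinity>"
    using fin by meson
  define c where "c = min a b"
  have c: "0 < c" using a b by (simp add: c_def)
  have scale: "F (c *\<^sub>R v) < \<infinity>" if "0 < d" "c \<le> d" "F (d *\<^sub>R v) < \<infinity>" for d v
  proof -
    have "F ((c / d) *\<^sub>R (d *\<^sub>R v)) \<le> ereal (c / d) * F (d *\<^sub>R v)"
      using that c by (intro ereal_convex_scale_le H_Phi_convex H_Phi_zero H_Phi_nonneg) auto
    also have "\<dots> < \<infinity>"
      using that H_Phi_nonneg[of "d *\<^sub>R v"] by (cases "F (d *\<^sub>R v)") auto
    finally show ?thesis using that by simp
  qed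
  have "sym_max F (c *\<^sub>R u) < \<infinity>"
    using scale[OF a(1) _ a(2)] scale[OF b(1) _ b(2)] by (auto simp: sym_max_def c_def max_def)
  then obtain M where M: "sym_max F (c *\<^sub>R u) = ereal M" "0 \<le> M"
    using sym_max_nonneg[of "c *\<^sub>R u"] by (cases "sym_max F (c *\<^sub>R u)") auto
  define t where "t = 1 / (M + 1)"
  have t: "0 < t" "t \<le> 1" using M by (auto simp: t_def field_simps)
  have "sym_max F (t *\<^sub>R (c *\<^sub>R u)) \<le> ereal t * sym_max F (c *\<^sub>R u)"
    by (rule sym_max_scale_le[OF t])
  also have "\<dots> \<le> 1"
    using M by (simp add: t_def field_simps)
  finally have "1 / (t * c) \<in> adm u"
    using t c by (simp add: adm_def divide_inverse)
  then show ?thesis by blast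
qed

private lemma lux_ge: "(\<And>\<alpha>. \<alpha> \<in> adm u \<Longrightarrow> m \<le> \<alpha>) \<Longrightarrow> m \<le> lux F u"
  unfolding lux_def adm_def[symmetric] by (intro cInf_greatest adm_nonempty)

text \<open>If \<open>lux F u\<close> vanishes, convexity forces
  \<open>F (t *\<^sub>R u) \<le> 0\<close> for all \<open>t\<close>, against the last condition of
  \<open>H_Phi\<close> unless \<open>u = 0\<close>. The triangle inequality is convexity with
  weights proportional to the two scales. Homogeneity is an inequality used for \<open>c\<close> and
  for \<open>inverse c\<close>.\<close>

lemma norm_fun_lux: "norm_fun (lux F)"
proof
  fix u assume u: "lux F u = 0"
  have "F (t *\<^sub>R u) \<le> 0" for t
  proof (cases "t = 0")
    case False
    show ?thesis
    proof (rule ereal_le_epsilon2)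
      fix e :: real assume e: "0 < e"
      \<comment> \<open>The 1 in the minimum keeps the factor
        \<open>\<bar>t\<bar> * \<alpha>\<close> at most 1, as scaling towards the origin requires;
        the \<open>e\<close> gives the final bound.\<close>
      define b where "b = min 1 e / \<bar>t\<bar>"
      have "0 < b" using e False by (simp add: b_def)
      have "\<exists>\<alpha>\<in>adm u. \<alpha> < b"
      proof (rule ccontr)
        assume "\<not> ?thesis"
        then have "b \<le> lux F u" by (intro lux_ge) (simp add: not_less)
        then show False using u \<open>0 < b\<close> by simp
      qed
      then obtain \<alpha> where \<alpha>: "\<alpha> \<in> adm u" "\<alpha> < b" by blast
      then have pos: "0 < \<alpha>" by (simp add: adm_def)
      have *: "\<bar>t\<bar> * \<alpha> \<le> min 1 e"
        using \<alpha>(2) False by (simp add: b_def field_simps)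
      have "F (t *\<^sub>R u) \<le> sym_max F (\<bar>t\<bar> *\<^sub>R u)"
        by (cases "0 \<le> t") (auto simp: sym_max_def)
      also have "\<dots> = sym_max F ((\<bar>t\<bar> * \<alpha>) *\<^sub>R (u /\<^sub>R \<alpha>))"
        using pos by (simp add: mult.assoc)
      also have "\<dots> \<le> ereal (\<bar>t\<bar> * \<alpha>) * sym_max F (u /\<^sub>R \<alpha>)"
        using * pos False by (intro sym_max_scale_le) auto
      also have "\<dots> \<le> ereal (\<bar>t\<bar> * \<alpha>) * 1"
        using \<alpha>(1) pos by (intro ereal_mult_left_mono) (auto simp: adm_def)
      also have "\<dots> \<le> 0 + ereal e"
        using * by simp
      finally show "F (t *\<^sub>R u) \<le> 0 + ereal e" .
    qed
  qed (simp add: H_Phi_zero)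
  then show "u = 0"
    using H unfolding H_Phi_def by (meson not_le)
next
  fix u v
  have sum: "a + b \<in> adm (u + v)" if a: "a \<in> adm u" and b: "b \<in> adm v" for a b
  proof -
    define t where "t = b / (a + b)"
    have pos: "0 < a" "0 < b" using a b by (auto simp: adm_def)
    then have t: "t \<in> {0<..<1}" "(1 - t) * inverse a = inverse (a + b)" "t * inverse b = inverse (a + b)"
      by (auto simp: t_def field_simps)
    have eq: "(u + v) /\<^sub>R (a + b) = (1 - t) *\<^sub>R (u /\<^sub>R a) + t *\<^sub>R (v /\<^sub>R b)"
      by (simp add: t scaleR_add_right)
    have "sym_max F ((u + v) /\<^sub>R (a + b)) \<le> ereal (1 - t) * sym_max F (u /\<^sub>R a) + ereal t * sym_max F (v /\<^sub>R b)"
      unfolding eq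
      by (rule ereal_convex_sym_max[OF H_Phi_convex, unfolded ereal_convex_def, rule_format, OF t(1)])
    also have "\<dots> \<le> ereal (1 - t) * 1 + ereal t * 1"
      using a b t(1) by (intro add_mono ereal_mult_left_mono) (auto simp: adm_def)
    also have "\<dots> = 1" by (simp add: one_ereal_def)
    finally show ?thesis using pos by (simp add: adm_def)
  qed
  have "lux F (u + v) - lux F v \<le> a" if a: "a \<in> adm u" for a
  proof -
    have "lux F (u + v) - a \<le> b" if "b \<in> adm v" for b
      using lux_le[OF sum[OF a that]] by linarith
    then have "lux F (u + v) - a \<le> lux F v" by (rule lux_ge)
    then show ?thesis by linarith
  qed
  then have "lux F (u + v) - lux F v \<le> lux F u" by (rule lux_ge)
  then show "lux F (u + v) \<le> lux F u + lux F v" by linarith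
next
  fix c u
  have lux_le_scale: "lux F (c *\<^sub>R u) \<le> \<bar>c\<bar> * lux F u" if c: "c \<noteq> 0" for c u
  proof -
    have "lux F (c *\<^sub>R u) / \<bar>c\<bar> \<le> a" if a: "a \<in> adm u" for a
    proof -
      have "sym_max F ((c *\<^sub>R u) /\<^sub>R (\<bar>c\<bar> * a)) = sym_max F (u /\<^sub>R a)"
      proof (cases "0 < c")
        case False
        then have "(c *\<^sub>R u) /\<^sub>R (\<bar>c\<bar> * a) = - (u /\<^sub>R a)"
          using c by simp
        then show ?thesis by (simp only: sym_max_minus)
      next
        case True
        then have "(c *\<^sub>R u) /\<^sub>R (\<bar>c\<bar> * a) = u /\<^sub>R a"
          by simp
        then show ?thesis by (simp only:)
      qed
      then have "\<bar>c\<bar> * a \<in> adm (c *\<^sub>R u)"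
        using a c by (simp add: adm_def)
      from lux_le[OF this] show ?thesis
        using c by (simp add: field_simps)
    qed
    then have "lux F (c *\<^sub>R u) / \<bar>c\<bar> \<le> lux F u" by (rule lux_ge)
    then show ?thesis using c by (simp add: field_simps)
  qed
  show "lux F (c *\<^sub>R u) = \<bar>c\<bar> * lux F u"
  proof (cases "c = 0")
    case True
    have "a \<in> adm 0" if "0 < a" for a
      using that by (simp add: adm_def sym_max_zero)
    then have "lux F 0 \<le> a" if "0 < a" for a
      using that lux_le by blast
    then have "lux F 0 \<le> 0" by (meson dense_ge)
    moreover have "0 \<le> lux F 0" by (rule lux_ge) (simp add: adm_def)
    ultimately show ?thesis using True by simp
  next
    case False
    have "lux F u \<le> \<bar>inverse c\<bar> * lux F (c *\<^sub>R u)"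
      using lux_le_scale[of "inverse c" "c *\<^sub>R u"] False by simp
    then have "\<bar>c\<bar> * lux F u \<le> lux F (c *\<^sub>R u)"
      using False by (simp add: field_simps)
    then show ?thesis using lux_le_scale[OF False, of u] by simp
  qed
qed

lemma Phi_star_nonneg: "0 \<le> Phi_star F l"
  unfolding Phi_star_def by (rule SUP_upper2[of 0]) (simp_all add: H_Phi_zero)

lemma Phi_star_zero: "Phi_star F 0 = 0"
proof (rule order_antisym[OF _ Phi_star_nonneg])
  show "Phi_star F 0 \<le> 0"
    unfolding Phi_star_def
  proof (rule SUP_least)
    show "ereal \<langle>u, 0\<rangle> - F u \<le> 0" for u
      using H_Phi_nonneg[of u] by (cases "F u") auto
  qed
qed

lemma Fenchel_Young: "ereal \<langle>u, l\<rangle> \<le> Phi_star F l + F u"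
proof -
  have "ereal \<langle>u, l\<rangle> - F u \<le> Phi_star F l"
    unfolding Phi_star_def by (rule SUP_upper) simp
  then show ?thesis
    using H_Phi_nonneg[of u] by (cases "F u"; cases "Phi_star F l") auto
qed

text \<open>The Fenchel-Young inequality at \<open>u / \<alpha>\<close> with
  \<open>F (u / \<alpha>) \<le> 1\<close> bounds the pairing by \<open>(K + 1) * \<alpha>\<close>,
  for every admissible \<open>\<alpha>\<close>. This is why primal minimizers of finite value are
  automatically continuous.\<close>

lemma Phi_star_finite_top_dual:
  assumes "Phi_star F l < \<infinity>"
  shows "l \<in> top_dual (lux F)"
proof -
  interpret norm_fun "lux F" by (rule norm_fun_lux)
  obtain K where K: "Phi_star F l = ereal K"
    using assms Phi_star_nonneg[of l] by (cases "Phi_star F l") auto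
  have "0 \<le> K" using Phi_star_nonneg[of l] K by simp
  have le: "\<langle>u, l\<rangle> \<le> (K + 1) * lux F u" for u
  proof -
    have "\<langle>u, l\<rangle> / (K + 1) \<le> \<alpha>" if \<alpha>: "\<alpha> \<in> adm u" for \<alpha>
    proof -
      have "ereal \<langle>u /\<^sub>R \<alpha>, l\<rangle> \<le> ereal K + F (u /\<^sub>R \<alpha>)"
        using Fenchel_Young[where u = "u /\<^sub>R \<alpha>" and l = l] K by simp
      also have "\<dots> \<le> ereal K + 1"
        using \<alpha> by (intro add_left_mono) (simp add: adm_def sym_max_def)
      finally have "\<langle>u, l\<rangle> / \<alpha> \<le> K + 1"
        by (simp add: divide_inverse mult.commute one_ereal_def)
      then show ?thesis
        using \<alpha> \<open>0 \<le> K\<close> by (simp add: adm_def field_simps)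
    qed
    then have "\<langle>u, l\<rangle> / (K + 1) \<le> lux F u" by (rule lux_ge)
    then show ?thesis using \<open>0 \<le> K\<close> by (simp add: field_simps)
  qed
  have "\<bar>\<langle>u, l\<rangle>\<bar> \<le> (K + 1) * lux F u" for u
    using le[of u] le[of "- u"] by (simp add: nrm_minus abs_le_iff)
  then show ?thesis by (auto simp: top_dual_iff)
qed

end

section \<open>The primal and the dual problem\<close>

lemma pairing_eqI: "u = v" if "\<And>l. \<langle>u, l\<rangle> = \<langle>v, l\<rangle>"
proof -
  have "canon u = canon v"
    using that by (subst app_inject[symmetric]) (auto simp: fun_eq_iff)
  then show ?thesis using inj_canon by (auto dest: injD)
qed

section \<open>The adjoint and the norms on the two spaces\<close>

locale duality =
  fixes \<Phi> :: "'u::real_vector \<Rightarrow> ereal" and T :: "'u adual \<Rightarrow> 'y::real_vector adual"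
  assumes H_Phi: "H_Phi \<Phi>" and linear_T: "linear T" and H_T: "H_T T"
begin

abbreviation "\<Lambda> \<equiv> Lam \<Phi> T"

lemmas Tstar = app_Tstar[OF linear_T H_T]

lemma linear_Tstar: "linear (Tstar T)"
  by (rule linearI; rule pairing_eqI) (simp_all add: Tstar)

text \<open>With this, everything proved for \<Phi> on conjugates and Luxemburg norms applies to
  \<Lambda> as well. The trivial kernel of the adjoint transfers the last condition of
  \<open>H_Phi\<close>.\<close>

lemma H_Phi_Lam: "H_Phi \<Lambda>"
proof -
  have "ereal_convex \<Lambda>"
    using H_Phi_convex[OF H_Phi]
    by (simp add: ereal_convex_def Lam_def linear_add[OF linear_Tstar] linear_scale[OF linear_Tstar])
  moreover have "\<exists>\<alpha>>0. \<Lambda> (\<alpha> *\<^sub>R y) < \<infinity>" for y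
    using H_Phi by (simp add: H_Phi_def Lam_def linear_scale[OF linear_Tstar])
  moreover have "\<exists>t. 0 < \<Lambda> (t *\<^sub>R y)" if "y \<noteq> 0" for y
  proof -
    have "Tstar T y \<noteq> 0"
    proof
      assume "Tstar T y = 0"
      then have "Tadj T y = 0"
        using Tstar[where y = y] by (subst app_inject[symmetric]) (auto simp: fun_eq_iff app_Tadj[OF linear_T])
      then show False using H_T that by (auto simp: H_T_def)
    qed
    then show ?thesis
      using H_Phi by (simp add: H_Phi_def Lam_def linear_scale[OF linear_Tstar])
  qed
  ultimately show ?thesis
    by (simp add: H_Phi_def Lam_def H_Phi_nonneg[OF H_Phi] H_Phi_zero[OF H_Phi] linear_0[OF linear_Tstar])
qed

lemma lux_Lam: "lux \<Lambda> y = lux \<Phi> (Tstar T y)"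
  by (simp add: lux_def sym_max_def Lam_def linear_scale[OF linear_Tstar] linear_neg[OF linear_Tstar])

sublocale U: norm_fun "lux \<Phi>"
  by (rule norm_fun_lux[OF H_Phi])

sublocale Y: norm_fun "lux \<Lambda>"
  by (rule norm_fun_lux[OF H_Phi_Lam])

lemma subspace_L1: "subspace (L1 \<Phi>)"
  unfolding L1_def by (rule U.subspace_top_dual)

lemma subspace_X1: "subspace (X1 \<Phi> T)"
  unfolding X1_def by (rule Y.subspace_top_dual)

text \<open>A constant bounding \<open>l\<close> also bounds \<open>T l\<close>, since
  \<open>T l\<close> is \<open>l\<close> after \<open>Tstar T\<close> and \<open>lux_Lam\<close>
  identifies the norms.\<close>

lemma T_L1: "l \<in> L1 \<Phi> \<Longrightarrow> T l \<in> X1 \<Phi> T"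
  unfolding L1_def X1_def U.top_dual_iff Y.top_dual_iff lux_Lam by (metis Tstar)

lemma Phi_star_finite_L1: "Phi_star \<Phi> l < \<infinity> \<Longrightarrow> l \<in> L1 \<Phi>"
  unfolding L1_def by (rule Phi_star_finite_top_dual[OF H_Phi])

lemma Phi_star_real:
  assumes "Phi_star \<Phi> l < \<infinity>"
  obtains k where "Phi_star \<Phi> l = ereal k"
  using assms Phi_star_nonneg[OF H_Phi, of l] by (cases "Phi_star \<Phi> l") auto

section \<open>The conjugate of \<open>Lam0\<close> as the value of the primal problem\<close>

lemma Phi0_le: "Phi0 \<Phi> u \<le> \<Phi> u"
  unfolding Phi0_def
proof (rule SUP_least)
  fix l show "ereal \<langle>u, l\<rangle> - Phi_star \<Phi> l \<le> \<Phi> u"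
    using Fenchel_Young[OF H_Phi, where u = u and l = l] Phi_star_nonneg[OF H_Phi, of l]
      H_Phi_nonneg[OF H_Phi, of u]
    by (cases "Phi_star \<Phi> l"; cases "\<Phi> u") auto
qed

lemma Lam0_star_nonneg: "0 \<le> Lam0_star \<Phi> T x"
proof -
  have "Lam0 \<Phi> T 0 \<le> 0"
    using Phi0_le[of 0] by (simp add: Lam0_def linear_0[OF linear_Tstar] H_Phi_zero[OF H_Phi])
  then have "0 \<le> ereal \<langle>0, x\<rangle> - Lam0 \<Phi> T 0"
    by (simp add: zero_ereal_def[symmetric] ereal_uminus_le_reorder)
  also have "\<dots> \<le> Lam0_star \<Phi> T x"
    unfolding Lam0_star_def by (rule SUP_upper) simp
  finally show ?thesis .
qed

text \<open>The easy half of the duality: the inequality defining \<open>Phi0\<close> is restricted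
  to the range of \<open>Tstar T\<close>.\<close>

lemma Lam0_star_T_le: "Lam0_star \<Phi> T (T l) \<le> Phi_star \<Phi> l"
proof (cases "Phi_star \<Phi> l < \<infinity>")
  case True
  then obtain k where k: "Phi_star \<Phi> l = ereal k" by (rule Phi_star_real)
  show ?thesis
    unfolding Lam0_star_def
  proof (rule SUP_least)
    fix y
    have "ereal \<langle>Tstar T y, l\<rangle> - ereal k \<le> Phi0 \<Phi> (Tstar T y)"
      unfolding Phi0_def k[symmetric] by (rule SUP_upper) simp
    then show "ereal \<langle>y, T l\<rangle> - Lam0 \<Phi> T y \<le> Phi_star \<Phi> l"
      unfolding Lam0_def k Tstar by (cases "Phi0 \<Phi> (Tstar T y)") auto
  qed
qed (simp add: not_less)

text \<open>Since \<open>T l\<close> is \<open>l\<close> composed with \<open>Tstar T\<close>,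
  solving \<open>T l = x\<close> amounts to extending a form along \<open>Tstar T\<close>; staying
  below \<open>\<Phi> + c\<close> is the bound on the conjugate.\<close>

lemma dominated_extension:
  assumes "\<And>y. ereal \<langle>y, x\<rangle> \<le> \<Phi> (Tstar T y) + ereal c"
  obtains l where "T l = x" "Phi_star \<Phi> l \<le> ereal c"
proof -
  have "\<exists>\<alpha>>0. \<Phi> (\<alpha> *\<^sub>R u) < \<infinity>" for u
    using H_Phi unfolding H_Phi_def by blast
  then obtain f where f: "linear f" "\<And>u. ereal (f u) \<le> \<Phi> u + ereal c"
    "\<And>y. f (Tstar T y) = \<langle>y, x\<rangle>"
    using convex_Hahn_Banach[OF H_Phi_nonneg[OF H_Phi] H_Phi_convex[OF H_Phi] H_Phi_zero[OF H_Phi] _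
        linear_Tstar linear_app assms] by metis
  define l where "l = Abs_adual f"
  have l: "\<langle>u, l\<rangle> = f u" for u
    using f(1) by (simp add: l_def Abs_adual_inverse)
  have "T l = x"
    by (subst app_inject[symmetric]) (simp add: fun_eq_iff Tstar[symmetric] l f(3))
  moreover have "Phi_star \<Phi> l \<le> ereal c"
    unfolding Phi_star_def
  proof (rule SUP_least)
    fix u show "ereal \<langle>u, l\<rangle> - \<Phi> u \<le> ereal c"
      using f(2)[of u] H_Phi_nonneg[OF H_Phi, of u] by (cases "\<Phi> u") (auto simp: l)
  qed
  ultimately show thesis by (rule that)
qed

lemma Lam0_star_attained:
  assumes "Lam0_star \<Phi> T x < \<infinity>"
  obtains l where "T l = x" "Phi_star \<Phi> l = Lam0_star \<Phi> T x"
proof -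
  obtain c where c: "Lam0_star \<Phi> T x = ereal c"
    using assms Lam0_star_nonneg[of x] by (cases "Lam0_star \<Phi> T x") auto
  have "ereal \<langle>y, x\<rangle> \<le> \<Phi> (Tstar T y) + ereal c" for y
  proof -
    have "ereal \<langle>y, x\<rangle> - Lam0 \<Phi> T y \<le> ereal c"
      unfolding c[symmetric] Lam0_star_def by (rule SUP_upper) simp
    then have "ereal \<langle>y, x\<rangle> \<le> Lam0 \<Phi> T y + ereal c"
      by (cases "Lam0 \<Phi> T y") auto
    also have "\<dots> \<le> \<Phi> (Tstar T y) + ereal c"
      unfolding Lam0_def by (intro add_right_mono Phi0_le)
    finally show ?thesis .
  qed
  then obtain l where l: "T l = x" "Phi_star \<Phi> l \<le> ereal c"
    using dominated_extension by blast
  then have "Phi_star \<Phi> l = Lam0_star \<Phi> T x"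
    using Lam0_star_T_le[of l] c by simp
  with l(1) show thesis by (rule that)
qed

lemma inf_P_eq:
  assumes "Lam0_star \<Phi> T x < \<infinity>"
  shows "inf_P \<Phi> T x = Lam0_star \<Phi> T x"
proof (rule order_antisym)
  obtain l where "T l = x" "Phi_star \<Phi> l = Lam0_star \<Phi> T x"
    using Lam0_star_attained[OF assms] .
  then show "inf_P \<Phi> T x \<le> Lam0_star \<Phi> T x"
    unfolding inf_P_def by (intro INF_lower2[of l]) auto
  show "Lam0_star \<Phi> T x \<le> inf_P \<Phi> T x"
    unfolding inf_P_def by (rule INF_greatest) (use Lam0_star_T_le in auto)
qed

section \<open>The extended adjoint and the functions \<open>Phi2\<close> and
  \<open>Lam2\<close>\<close>

lemma T2star_apply: "l \<in> L1 \<Phi> \<Longrightarrow> T2star \<Phi> T \<omega> l = \<omega> (T l)"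
  by (simp add: T2star_def)

lemma T2star_adual: "\<omega> \<in> adual_on (X1 \<Phi> T) \<Longrightarrow> T2star \<Phi> T \<omega> \<in> adual_on (L1 \<Phi>)"
  unfolding T2star_def
  by (rule restrict_adual_onI[OF subspace_L1])
    (simp_all add: linear_add[OF linear_T] linear_scale[OF linear_T] adual_on_add adual_on_scale T_L1)

lemma Phi2_upper: "l \<in> L1 \<Phi> \<Longrightarrow> ereal (\<zeta> l) - Phi_star \<Phi> l \<le> Phi2 \<Phi> \<zeta>"
  unfolding Phi2_def by (rule SUP_upper)

lemma Phi2_nonneg:
  assumes "\<zeta> \<in> adual_on (L1 \<Phi>)"
  shows "0 \<le> Phi2 \<Phi> \<zeta>"
  using Phi2_upper[OF subspace_0[OF subspace_L1], of \<zeta>] adual_on_scale[OF assms subspace_0[OF subspace_L1], of 0]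
  by (simp add: Phi_star_zero[OF H_Phi] flip: zero_ereal_def)

lemma Phi2_embed_le: "Phi2 \<Phi> (\<lambda>l\<in>L1 \<Phi>. \<langle>u, l\<rangle>) \<le> \<Phi> u"
proof -
  have "Phi2 \<Phi> (\<lambda>l\<in>L1 \<Phi>. \<langle>u, l\<rangle>) \<le> Phi0 \<Phi> u"
    unfolding Phi2_def Phi0_def by (rule SUP_mono) auto
  then show ?thesis using Phi0_le order_trans by blast
qed

text \<open>The values of \<^const>\<open>Phi2\<close> at the evaluations \<open>l \<mapsto> \<langle>u, l\<rangle>\<close> already recover
  \<^const>\<open>Phi_star\<close> as the conjugate of \<^const>\<open>Phi2\<close>.\<close>

lemma subdiff_Phi2_iff:
  assumes l: "l \<in> L1 \<Phi>" and \<zeta>: "\<zeta> \<in> adual_on (L1 \<Phi>)"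
  shows "l \<in> subdiff_Phi2 \<Phi> \<zeta> \<longleftrightarrow> Phi_star \<Phi> l + Phi2 \<Phi> \<zeta> = ereal (\<zeta> l)"
proof
  assume sub: "l \<in> subdiff_Phi2 \<Phi> \<zeta>"
  have key: "Phi2 \<Phi> \<zeta> + ereal (\<langle>u, l\<rangle> - \<zeta> l) \<le> \<Phi> u" for u
  proof -
    \<comment> \<open>This direction moves \<open>\<zeta>\<close> to the evaluation at
      \<open>u\<close>, where \<open>Phi2\<close> is at most \<open>\<Phi> u\<close>.\<close>
    define \<xi> where "\<xi> = (\<lambda>m\<in>L1 \<Phi>. \<langle>u, m\<rangle> - \<zeta> m)"
    have "\<xi> \<in> adual_on (L1 \<Phi>)"
      unfolding \<xi>_def
      by (rule restrict_adual_onI[OF subspace_L1])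
        (simp_all add: adual_on_add[OF \<zeta>] adual_on_scale[OF \<zeta>] algebra_simps)
    then have "Phi2 \<Phi> \<zeta> + ereal (\<xi> l) \<le> Phi2 \<Phi> (\<lambda>m\<in>L1 \<Phi>. \<zeta> m + \<xi> m)"
      using sub unfolding subdiff_Phi2_def by blast
    moreover have "(\<lambda>m\<in>L1 \<Phi>. \<zeta> m + \<xi> m) = (\<lambda>m\<in>L1 \<Phi>. \<langle>u, m\<rangle>)"
      by (rule restrict_ext) (simp add: \<xi>_def)
    ultimately show ?thesis
      using Phi2_embed_le[of u] l by (simp add: \<xi>_def)
  qed
  \<comment> \<open>At \<open>u = 0\<close> the inequality \<open>key\<close> bounds
    \<open>Phi2 \<Phi> \<zeta>\<close> above by a real number.\<close>
  obtain r where r: "Phi2 \<Phi> \<zeta> = ereal r"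
    using key[of 0] Phi2_nonneg[OF \<zeta>] H_Phi_zero[OF H_Phi] by (cases "Phi2 \<Phi> \<zeta>") auto
  have "Phi_star \<Phi> l \<le> ereal (\<zeta> l - r)"
    unfolding Phi_star_def
  proof (rule SUP_least)
    fix u show "ereal \<langle>u, l\<rangle> - \<Phi> u \<le> ereal (\<zeta> l - r)"
      using key[of u] r by (cases "\<Phi> u") auto
  qed
  moreover have "ereal (\<zeta> l) - Phi_star \<Phi> l \<le> ereal r"
    using Phi2_upper[OF l, of \<zeta>] r by simp
  ultimately show "Phi_star \<Phi> l + Phi2 \<Phi> \<zeta> = ereal (\<zeta> l)"
    unfolding r by (cases "Phi_star \<Phi> l") auto
next
  assume eq: "Phi_star \<Phi> l + Phi2 \<Phi> \<zeta> = ereal (\<zeta> l)"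
  have "Phi2 \<Phi> \<zeta> + ereal (\<xi> l) = ereal (\<zeta> l + \<xi> l) - Phi_star \<Phi> l" for \<xi>
    using eq by (cases "Phi_star \<Phi> l"; cases "Phi2 \<Phi> \<zeta>") auto
  then have "Phi2 \<Phi> \<zeta> + ereal (\<xi> l) \<le> Phi2 \<Phi> (\<lambda>m\<in>L1 \<Phi>. \<zeta> m + \<xi> m)" for \<xi>
    using Phi2_upper[OF l, of "\<lambda>m\<in>L1 \<Phi>. \<zeta> m + \<xi> m"] l by simp
  then show "l \<in> subdiff_Phi2 \<Phi> \<zeta>"
    using l by (simp add: subdiff_Phi2_def)
qed

lemma Lam2_nonneg: "\<omega> \<in> adual_on (X1 \<Phi> T) \<Longrightarrow> 0 \<le> Lam2 \<Phi> T \<omega>"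
  unfolding Lam2_def by (intro Phi2_nonneg T2star_adual)

text \<open>A minimizer \<open>l\<close> over \<open>T l = x\<close> attains
  \<open>Lam0_star\<close>, so the inequality defining \<open>Phi2\<close> at \<open>l\<close>
  becomes one between \<open>x\<close> and \<open>\<omega>\<close>.\<close>

lemma Lam2_Young:
  assumes "\<omega> \<in> adual_on (X1 \<Phi> T)"
  shows "ereal (\<omega> x) \<le> Lam0_star \<Phi> T x + Lam2 \<Phi> T \<omega>"
proof (cases "Lam0_star \<Phi> T x < \<infinity>")
  case True
  then obtain l where l: "T l = x" "Phi_star \<Phi> l = Lam0_star \<Phi> T x"
    by (rule Lam0_star_attained)
  then have L1: "l \<in> L1 \<Phi>" using True Phi_star_finite_L1 by simp
  obtain k where k: "Phi_star \<Phi> l = ereal k"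
    using l True Phi_star_real by metis
  have "ereal (\<omega> x) - ereal k \<le> Lam2 \<Phi> T \<omega>"
    using Phi2_upper[OF L1, of "T2star \<Phi> T \<omega>"] L1 l k by (simp add: T2star_apply Lam2_def)
  then show ?thesis
    using k unfolding l(2) by (cases "Lam2 \<Phi> T \<omega>") (auto simp: algebra_simps)
qed (use Lam2_nonneg[OF assms] in auto)

lemma weak_duality:
  assumes "\<omega> \<in> adual_on (X1 \<Phi> T)"
  shows "ereal (\<omega> x) - Lam2 \<Phi> T \<omega> \<le> Lam0_star \<Phi> T x"
  using Lam2_Young[OF assms, of x] Lam2_nonneg[OF assms] Lam0_star_nonneg[of x]
  by (cases "Lam0_star \<Phi> T x"; cases "Lam2 \<Phi> T \<omega>") auto

text \<open>By \<open>dominated_extension\<close> the conjugate of \<open>\<Lambda>\<close> dominates \<open>Lam0_star\<close>, so \<open>Lam2\<close> dominates the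
  biconjugate of \<open>\<Lambda>\<close>; this is why no point of the completion outside \<open>Y\<close> is needed.\<close>

lemma Lam2_finite_approx:
  assumes \<omega>: "\<omega> \<in> adual_on (X1 \<Phi> T)" and fin: "Lam2 \<Phi> T \<omega> < \<infinity>"
    and I: "finite I" "I \<subseteq> X1 \<Phi> T" and e: "0 < e"
  obtains y where "\<Lambda> y < \<infinity>" "\<And>x. x \<in> I \<Longrightarrow> \<bar>\<omega> x - \<langle>y, x\<rangle>\<bar> < e"
proof -
  obtain M where M: "Lam2 \<Phi> T \<omega> = ereal M"
    using fin Lam2_nonneg[OF \<omega>] by (cases "Lam2 \<Phi> T \<omega>") auto
  have "ereal (\<omega> x) \<le> Phi_star \<Lambda> x + ereal M" for x
  proof (cases "Phi_star \<Lambda> x < \<infinity>")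
    case True
    then obtain c where c: "Phi_star \<Lambda> x = ereal c"
      using Phi_star_nonneg[OF H_Phi_Lam, of x] by (cases "Phi_star \<Lambda> x") auto
    have "ereal \<langle>y, x\<rangle> \<le> \<Phi> (Tstar T y) + ereal c" for y
      using Fenchel_Young[OF H_Phi_Lam, where u = y and l = x]
      by (simp add: c Lam_def add.commute)
    then obtain l where l: "T l = x" "Phi_star \<Phi> l \<le> ereal c"
      using dominated_extension by blast
    then have "ereal (\<omega> x) \<le> Lam0_star \<Phi> T x + ereal M"
      using Lam2_Young[OF \<omega>] M by metis
    also have "\<dots> \<le> ereal c + ereal M"
      using l Lam0_star_T_le[of l] by (intro add_right_mono) auto
    finally show ?thesis by (simp add: c)
  qed (simp add: not_less)
  moreover have "edom \<Lambda> \<noteq> {}"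
    using H_Phi_zero[OF H_Phi_Lam] by (auto simp: edom_def intro!: exI[of _ 0])
  ultimately obtain y where "y \<in> edom \<Lambda>" "\<forall>x\<in>I. \<bar>\<omega> x - \<langle>y, x\<rangle>\<bar> < e"
    using biconjugate_dom_approx[OF H_Phi_nonneg[OF H_Phi_Lam] H_Phi_convex[OF H_Phi_Lam] _
        subspace_X1 \<omega> _ I e] by blast
  then show thesis by (auto simp: edom_def intro: that)
qed

section \<open>Points of the original spaces in the completions, and the weak closures\<close>

lemma T2star_const_class:
  "T2star \<Phi> T (cemb (lux \<Lambda>) (Y.const_class y)) = (\<lambda>l\<in>L1 \<Phi>. \<langle>Tstar T y, l\<rangle>)"
  unfolding T2star_def Y.cemb_const_class
  by (rule restrict_ext) (use T_L1 in \<open>simp add: X1_def Tstar\<close>)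

text \<open>\<open>T1star\<close> chooses a preimage under \<open>cemb\<close>. At a constant class
  one exists, the class of \<open>Tstar T y\<close>, so applying \<open>cemb\<close> undoes the
  choice.\<close>

lemma cemb_T1star_const_class:
  "cemb (lux \<Phi>) (T1star \<Phi> T (Y.const_class y)) = (\<lambda>l\<in>L1 \<Phi>. \<langle>Tstar T y, l\<rangle>)"
proof -
  have "(\<lambda>l\<in>L1 \<Phi>. \<langle>Tstar T y, l\<rangle>) \<in> cemb (lux \<Phi>) ` U1 \<Phi>"
    unfolding L1_def U.cemb_const_class[symmetric] U1_def
    by (rule imageI) (rule U.const_class_completion)
  then show ?thesis
    unfolding T1star_def T2star_const_class by (rule f_inv_into_f)
qed

lemma const_class_dom_Lam1:
  assumes "\<Lambda> y < \<infinity>"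
  shows "Y.const_class y \<in> dom_Lam1 \<Phi> T"
proof -
  have "cpair (T1star \<Phi> T (Y.const_class y)) l = \<langle>Tstar T y, l\<rangle>" if "l \<in> L1 \<Phi>" for l
    using fun_cong[OF cemb_T1star_const_class, of y l] that by (simp add: cemb_def L1_def)
  then have "Lam1 \<Phi> T (Y.const_class y) = Phi2 \<Phi> (\<lambda>l\<in>L1 \<Phi>. \<langle>Tstar T y, l\<rangle>)"
    unfolding Lam1_def Phi1_def Phi2_def by (intro SUP_cong) auto
  also have "\<dots> \<le> \<Lambda> y"
    unfolding Lam_def by (rule Phi2_embed_le)
  finally have "Lam1 \<Phi> T (Y.const_class y) < \<infinity>"
    using assms by (rule order.strict_trans1)
  then show ?thesis
    by (simp add: dom_Lam1_def Y1_def Y.const_class_completion)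
qed

lemma embed_adual_on_L1: "(\<lambda>l\<in>L1 \<Phi>. \<langle>u, l\<rangle>) \<in> adual_on (L1 \<Phi>)"
  by (rule restrict_adual_onI[OF subspace_L1]) simp_all

lemma embed_adual_on_X1: "(\<lambda>x\<in>X1 \<Phi> T. \<langle>y, x\<rangle>) \<in> adual_on (X1 \<Phi> T)"
  by (rule restrict_adual_onI[OF subspace_X1]) simp_all

lemma Lam2_finite_closure:
  assumes \<omega>: "\<omega> \<in> adual_on (X1 \<Phi> T)" and fin: "Lam2 \<Phi> T \<omega> < \<infinity>"
  shows "\<omega> \<in> weak_top (X1 \<Phi> T) closure_of (cemb (lux \<Lambda>) ` dom_Lam1 \<Phi> T)"
proof (rule weak_top_closureI[OF subspace_X1 \<omega>])
  fix I and e :: real assume I: "finite I" "I \<subseteq> X1 \<Phi> T" "0 < e"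
  obtain y where y: "\<Lambda> y < \<infinity>" "\<And>x. x \<in> I \<Longrightarrow> \<bar>\<omega> x - \<langle>y, x\<rangle>\<bar> < e"
    using Lam2_finite_approx[OF \<omega> fin I] by blast
  have "(\<lambda>x\<in>X1 \<Phi> T. \<langle>y, x\<rangle>) \<in> cemb (lux \<Lambda>) ` dom_Lam1 \<Phi> T"
    unfolding X1_def Y.cemb_const_class[symmetric] by (intro imageI const_class_dom_Lam1 y(1))
  then show "\<exists>\<omega>'\<in>cemb (lux \<Lambda>) ` dom_Lam1 \<Phi> T. \<omega>' \<in> adual_on (X1 \<Phi> T) \<and> (\<forall>x\<in>I. \<bar>\<omega> x - \<omega>' x\<bar> < e)"
    using y(2) I(2) embed_adual_on_X1
    by (intro bexI[of _ "\<lambda>x\<in>X1 \<Phi> T. \<langle>y, x\<rangle>"]) auto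
qed

text \<open>Testing \<open>T2star \<Phi> T \<omega>\<close> on finitely many \<open>l\<close> is
  testing \<omega> on their images \<open>T l\<close>, so the approximants of \<omega> serve again.
  The set \<open>A\<close> is left general because two closures are obtained from the same
  approximants.\<close>

lemma T2star_closure:
  assumes \<omega>: "\<omega> \<in> adual_on (X1 \<Phi> T)" and fin: "Lam2 \<Phi> T \<omega> < \<infinity>"
    and A: "\<And>y. \<Lambda> y < \<infinity> \<Longrightarrow> (\<lambda>l\<in>L1 \<Phi>. \<langle>Tstar T y, l\<rangle>) \<in> A"
  shows "T2star \<Phi> T \<omega> \<in> weak_top (L1 \<Phi>) closure_of A"
proof (rule weak_top_closureI[OF subspace_L1 T2star_adual[OF \<omega>]])
  fix I and e :: real assume I: "finite I" "I \<subseteq> L1 \<Phi>" "0 < e"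
  then have TI: "finite (T ` I)" "T ` I \<subseteq> X1 \<Phi> T"
    using T_L1 by auto
  obtain y where y: "\<Lambda> y < \<infinity>" "\<And>x. x \<in> T ` I \<Longrightarrow> \<bar>\<omega> x - \<langle>y, x\<rangle>\<bar> < e"
    using Lam2_finite_approx[OF \<omega> fin TI I(3)] by blast
  then have "\<forall>l\<in>I. \<bar>T2star \<Phi> T \<omega> l - (\<lambda>l\<in>L1 \<Phi>. \<langle>Tstar T y, l\<rangle>) l\<bar> < e"
    using I(2) by (auto simp: T2star_apply Tstar subset_iff)
  then show "\<exists>\<omega>'\<in>A. \<omega>' \<in> adual_on (L1 \<Phi>) \<and> (\<forall>l\<in>I. \<bar>T2star \<Phi> T \<omega> l - \<omega>' l\<bar> < e)"
    using A[OF y(1)] embed_adual_on_L1 by blast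
qed

text \<open>The subgradient inequality gives \<open>\<omega> \<le> 1\<close> on \<open>Dset\<close>.
  A gauge value below \<open>e\<close> writes \<open>x\<close> as
  \<open>\<alpha> *\<^sub>R d\<close> with \<open>\<alpha> < e\<close>, whence
  \<open>\<omega> x < e\<close>: one may take \<delta> equal to \<epsilon>. Reflection reverses the
  sign.\<close>

lemma gauge_semicontinuous:
  assumes sub: "\<And>x. x \<in> X1 \<Phi> T \<Longrightarrow> Lam0_star \<Phi> T xb + ereal (\<omega> (x - xb)) \<le> Lam0_star \<Phi> T x"
    and xb: "xb \<in> X1 \<Phi> T" and fin: "Lam0_star \<Phi> T xb < \<infinity>" and \<omega>: "\<omega> \<in> adual_on (X1 \<Phi> T)"
  shows "gauge_usc (X1 \<Phi> T) (gauge_fun (Dset \<Phi> T xb)) \<omega>"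
    and "gauge_lsc (X1 \<Phi> T) (gauge_fun (uminus ` Dset \<Phi> T xb)) \<omega>"
proof -
  have D: "\<omega> x \<le> 1" if "x \<in> Dset \<Phi> T xb" for x
  proof -
    have x: "x \<in> X1 \<Phi> T" "Lam0_star \<Phi> T (xb + x) \<le> Lam0_star \<Phi> T xb + 1"
      using that by (auto simp: Dset_def)
    have "Lam0_star \<Phi> T xb + ereal (\<omega> x) \<le> Lam0_star \<Phi> T (xb + x)"
      using sub[of "xb + x"] xb x subspace_add[OF subspace_X1] by simp
    then have "Lam0_star \<Phi> T xb + ereal (\<omega> x) \<le> Lam0_star \<Phi> T xb + 1"
      using x(2) by (rule order_trans)
    then show ?thesis
      using fin Lam0_star_nonneg[of xb] by (cases "Lam0_star \<Phi> T xb") (auto simp: one_ereal_def)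
  qed
  have "\<omega> x < e" if "gauge_fun (Dset \<Phi> T xb) x < ereal e" for x e
  proof -
    obtain \<alpha> d where "0 < \<alpha>" "\<alpha> < e" "d \<in> Dset \<Phi> T xb" "x = \<alpha> *\<^sub>R d"
      using \<open>gauge_fun (Dset \<Phi> T xb) x < ereal e\<close> by (auto simp: gauge_fun_def Inf_less_iff)
    moreover from this have "\<omega> x = \<alpha> * \<omega> d"
      using adual_on_scale[OF \<omega>] by (simp add: Dset_def)
    moreover have "\<alpha> * \<omega> d \<le> \<alpha> * 1"
      using D[OF \<open>d \<in> _\<close>] \<open>0 < \<alpha>\<close> by (intro mult_left_mono) auto
    ultimately show ?thesis by linarith
  qed
  then show "gauge_usc (X1 \<Phi> T) (gauge_fun (Dset \<Phi> T xb)) \<omega>"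
    unfolding gauge_usc_def by blast
  have "- e < \<omega> x" if "gauge_fun (uminus ` Dset \<Phi> T xb) x < ereal e" for x e
  proof -
    obtain \<alpha> d where "0 < \<alpha>" "\<alpha> < e" "d \<in> Dset \<Phi> T xb" "x = \<alpha> *\<^sub>R (- d)"
      using \<open>gauge_fun (uminus ` Dset \<Phi> T xb) x < ereal e\<close> by (auto simp: gauge_fun_def Inf_less_iff)
    moreover from this have "\<omega> x = - (\<alpha> * \<omega> d)"
      using adual_on_scale[OF \<omega>, of d "- \<alpha>"] by (simp add: Dset_def)
    moreover have "\<alpha> * \<omega> d \<le> \<alpha> * 1"
      using D[OF \<open>d \<in> _\<close>] \<open>0 < \<alpha>\<close> by (intro mult_left_mono) auto
    ultimately show ?thesis by linarith
  qed
  then show "gauge_lsc (X1 \<Phi> T) (gauge_fun (uminus ` Dset \<Phi> T xb)) \<omega>"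
    unfolding gauge_lsc_def by blast
qed

section \<open>Optimality at a point where \<open>Lam0_star\<close> is finite and has a
  subgradient\<close>

context
  fixes xb
  assumes diff: "xb \<in> diffdom_Lam0_star \<Phi> T" and fin: "Lam0_star \<Phi> T xb < \<infinity>"
begin

lemma diffdom_X1: "xb \<in> X1 \<Phi> T"
  using diff by (simp add: diffdom_Lam0_star_def)

lemma Lam0_star_real: obtains c where "Lam0_star \<Phi> T xb = ereal c"
  using fin Lam0_star_nonneg[of xb] by (cases "Lam0_star \<Phi> T xb") auto

text \<open>Testing the subgradient inequality at the points \<open>T l\<close>, where
  \<open>Lam0_star\<close> is at most \<open>Phi_star \<Phi> l\<close>, bounds
  \<open>Lam2 \<Phi> T \<omega>\<close> by \<open>\<omega> xb - c\<close>. Weak duality is the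
  reverse inequality.\<close>

lemma dual_attained:
  obtains \<omega> where "\<omega> \<in> adual_on (X1 \<Phi> T)" "ereal (\<omega> xb) - Lam2 \<Phi> T \<omega> = Lam0_star \<Phi> T xb"
proof -
  obtain c where c: "Lam0_star \<Phi> T xb = ereal c" by (rule Lam0_star_real)
  obtain \<omega> where \<omega>: "\<omega> \<in> adual_on (X1 \<Phi> T)"
    "\<And>x. x \<in> X1 \<Phi> T \<Longrightarrow> Lam0_star \<Phi> T xb + ereal (\<omega> (x - xb)) \<le> Lam0_star \<Phi> T x"
    using diff by (auto simp: diffdom_Lam0_star_def)
  have "Lam2 \<Phi> T \<omega> \<le> ereal (\<omega> xb - c)"
    unfolding Lam2_def Phi2_def
  proof (rule SUP_least)
    fix l assume l: "l \<in> L1 \<Phi>"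
    have "ereal (c + (\<omega> (T l) - \<omega> xb)) \<le> Lam0_star \<Phi> T (T l)"
      using \<omega>(2)[OF T_L1[OF l]] c
        adual_on_diff[OF \<omega>(1) subspace_X1 T_L1[OF l] diffdom_X1] by simp
    also have "\<dots> \<le> Phi_star \<Phi> l" by (rule Lam0_star_T_le)
    finally show "ereal (T2star \<Phi> T \<omega> l) - Phi_star \<Phi> l \<le> ereal (\<omega> xb - c)"
      using l by (cases "Phi_star \<Phi> l") (auto simp: T2star_apply)
  qed
  then have "ereal c \<le> ereal (\<omega> xb) - Lam2 \<Phi> T \<omega>"
    using Lam2_nonneg[OF \<omega>(1)] by (cases "Lam2 \<Phi> T \<omega>") auto
  then have "ereal (\<omega> xb) - Lam2 \<Phi> T \<omega> = Lam0_star \<Phi> T xb"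
    using weak_duality[OF \<omega>(1), of xb] c by simp
  with \<omega>(1) show thesis by (rule that)
qed

lemma sup_D2_eq: "sup_D2 \<Phi> T xb = Lam0_star \<Phi> T xb"
proof (rule order_antisym)
  show "sup_D2 \<Phi> T xb \<le> Lam0_star \<Phi> T xb"
    unfolding sup_D2_def by (intro SUP_least weak_duality)
  obtain \<omega> where \<omega>: "\<omega> \<in> adual_on (X1 \<Phi> T)" "ereal (\<omega> xb) - Lam2 \<Phi> T \<omega> = Lam0_star \<Phi> T xb"
    by (rule dual_attained)
  show "Lam0_star \<Phi> T xb \<le> sup_D2 \<Phi> T xb"
    unfolding sup_D2_def \<omega>(2)[symmetric] by (rule SUP_upper[OF \<omega>(1)])
qed

lemma sol_D2_iff:
  "\<omega> \<in> sol_D2 \<Phi> T xb \<longleftrightarrow> \<omega> \<in> adual_on (X1 \<Phi> T) \<and> ereal (\<omega> xb) - Lam2 \<Phi> T \<omega> = Lam0_star \<Phi> T xb"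
  by (simp add: sol_D2_def sup_D2_eq)

lemma sol_P_iff: "l \<in> sol_P \<Phi> T xb \<longleftrightarrow> T l = xb \<and> Phi_star \<Phi> l = Lam0_star \<Phi> T xb"
  by (simp add: sol_P_def inf_P_eq[OF fin])

lemma sol_D2_Lam2:
  assumes "\<omega> \<in> sol_D2 \<Phi> T xb"
  obtains c m where "Lam0_star \<Phi> T xb = ereal c" "Lam2 \<Phi> T \<omega> = ereal m" "\<omega> xb = c + m"
proof -
  obtain c where c: "Lam0_star \<Phi> T xb = ereal c" by (rule Lam0_star_real)
  then obtain m where "Lam2 \<Phi> T \<omega> = ereal m" "\<omega> xb = c + m"
    using assms unfolding sol_D2_iff by (cases "Lam2 \<Phi> T \<omega>") auto
  with c show thesis by (rule that)
qed

text \<open>Young's inequality at \<open>x\<close> minus its equality case at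
  \<open>xb\<close>.\<close>

lemma sol_D2_subgradient:
  assumes "\<omega> \<in> sol_D2 \<Phi> T xb" "x \<in> X1 \<Phi> T"
  shows "Lam0_star \<Phi> T xb + ereal (\<omega> (x - xb)) \<le> Lam0_star \<Phi> T x"
proof -
  obtain c m where cm: "Lam0_star \<Phi> T xb = ereal c" "Lam2 \<Phi> T \<omega> = ereal m" "\<omega> xb = c + m"
    using assms(1) by (rule sol_D2_Lam2)
  have \<omega>: "\<omega> \<in> adual_on (X1 \<Phi> T)"
    using assms(1) by (simp add: sol_D2_def)
  show ?thesis
    using Lam2_Young[OF \<omega>, of x] cm adual_on_diff[OF \<omega> subspace_X1 assms(2) diffdom_X1]
    by (cases "Lam0_star \<Phi> T x") auto
qed

text \<open>The dual value at \<omega>, \<open>Lam0_star\<close> at \<open>xb\<close> and the primal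
  value at \<open>l\<close> form an increasing chain; the Fenchel equality identifies its ends,
  which is joint optimality. Conversely, optimal values add up to
  \<open>\<omega> xb\<close>.\<close>

lemma Fenchel_equality_iff:
  assumes l: "l \<in> L1 \<Phi>" and \<omega>: "\<omega> \<in> adual_on (X1 \<Phi> T)"
  shows "T l = xb \<and> l \<in> subdiff_Phi2 \<Phi> (T2star \<Phi> T \<omega>) \<longleftrightarrow>
    l \<in> sol_P \<Phi> T xb \<and> \<omega> \<in> sol_D2 \<Phi> T xb"
proof
  assume "T l = xb \<and> l \<in> subdiff_Phi2 \<Phi> (T2star \<Phi> T \<omega>)"
  then have Tl: "T l = xb" and eq: "Phi_star \<Phi> l + Lam2 \<Phi> T \<omega> = ereal (\<omega> xb)"
    using l by (auto simp: subdiff_Phi2_iff T2star_adual \<omega> Lam2_def T2star_apply)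
  then have "Phi_star \<Phi> l = ereal (\<omega> xb) - Lam2 \<Phi> T \<omega>"
    by (cases "Phi_star \<Phi> l"; cases "Lam2 \<Phi> T \<omega>") auto
  moreover have "ereal (\<omega> xb) - Lam2 \<Phi> T \<omega> \<le> Lam0_star \<Phi> T xb"
    by (rule weak_duality[OF \<omega>])
  moreover have "Lam0_star \<Phi> T xb \<le> Phi_star \<Phi> l"
    using Lam0_star_T_le[of l] Tl by simp
  ultimately show "l \<in> sol_P \<Phi> T xb \<and> \<omega> \<in> sol_D2 \<Phi> T xb"
    using Tl \<omega> by (simp add: sol_P_iff sol_D2_iff)
next
  assume *: "l \<in> sol_P \<Phi> T xb \<and> \<omega> \<in> sol_D2 \<Phi> T xb"
  then obtain c m where "Lam0_star \<Phi> T xb = ereal c" "Lam2 \<Phi> T \<omega> = ereal m" "\<omega> xb = c + m"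
    using sol_D2_Lam2 by blast
  with * show "T l = xb \<and> l \<in> subdiff_Phi2 \<Phi> (T2star \<Phi> T \<omega>)"
    using l by (auto simp: subdiff_Phi2_iff T2star_adual \<omega> Lam2_def T2star_apply sol_P_iff)
qed

end

end

section \<open>Assembly of the statements (a), (b) and (c)\<close>

theorem theorem2p13:
  fixes \<Phi> :: "'u::real_vector \<Rightarrow> ereal"
    and T :: "'u adual \<Rightarrow> 'y::real_vector adual"
    and xb :: "'y adual"
  assumes "H_Phi \<Phi>"
    and "linear T"
    and "H_T T"
    and "xb \<in> edom (Lam0_star \<Phi> T)"
  shows "inf_P \<Phi> T xb < \<infinity> \<and>
    (xb \<in> diffdom_Lam0_star \<Phi> T \<longrightarrow>
      \<comment> \<open>(a)\<close>
      ((\<exists>l\<in>L1 \<Phi>. l \<in> sol_P \<Phi> T xb) \<and>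
       (\<exists>\<omega>\<in>adual_on (X1 \<Phi> T). \<omega> \<in> sol_D2 \<Phi> T xb)) \<and>
      \<comment> \<open>(b)\<close>
      ((\<forall>l\<in>L1 \<Phi>. l \<in> sol_P \<Phi> T xb \<longleftrightarrow>
          T l = xb \<and> (\<exists>\<omega>\<in>adual_on (X1 \<Phi> T). l \<in> subdiff_Phi2 \<Phi> (T2star \<Phi> T \<omega>))) \<and>
       (\<forall>l\<in>L1 \<Phi>. \<forall>\<omega>\<in>adual_on (X1 \<Phi> T).
          l \<in> subdiff_Phi2 \<Phi> (T2star \<Phi> T \<omega>) \<longleftrightarrow>
          Phi_star \<Phi> l + Phi2 \<Phi> (T2star \<Phi> T \<omega>) = ereal (\<omega> (T l))) \<and>
       (\<forall>l\<in>L1 \<Phi>. \<forall>\<omega>\<in>adual_on (X1 \<Phi> T).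
          (T l = xb \<and> l \<in> subdiff_Phi2 \<Phi> (T2star \<Phi> T \<omega>)) \<longleftrightarrow>
          (l \<in> sol_P \<Phi> T xb \<and> \<omega> \<in> sol_D2 \<Phi> T xb \<and> xb = T l \<and>
           inf_P \<Phi> T xb = sup_D2 \<Phi> T xb))) \<and>
      \<comment> \<open>(c)\<close>
      (\<forall>\<omega>\<in>sol_D2 \<Phi> T xb.
         \<omega> \<in> weak_top (X1 \<Phi> T) closure_of (cemb (lux (Lam \<Phi> T)) ` dom_Lam1 \<Phi> T) \<and>
         T2star \<Phi> T \<omega> \<in> weak_top (L1 \<Phi>) closure_of
            (cemb (lux \<Phi>) ` T1star \<Phi> T ` dom_Lam1 \<Phi> T) \<and>
         T2star \<Phi> T \<omega> \<in> weak_top (L1 \<Phi>) closure_of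
            ((\<lambda>u. restrict (app (canon u)) (L1 \<Phi>)) ` edom \<Phi>) \<and>
         (xb \<in> icor (edom (Lam0_star \<Phi> T)) \<longrightarrow>
            gauge_usc (X1 \<Phi> T) (gauge_fun (Dset \<Phi> T xb)) \<omega> \<and>
            gauge_lsc (X1 \<Phi> T) (gauge_fun (uminus ` Dset \<Phi> T xb)) \<omega>)))"
proof -
  interpret duality \<Phi> T
    by (rule duality.intro[OF assms(1-3)])
  have fin: "Lam0_star \<Phi> T xb < \<infinity>"
    using assms(4) by (simp add: edom_def)
  show ?thesis
  proof (intro conjI impI)
    show "inf_P \<Phi> T xb < \<infinity>"
      using fin by (simp only: inf_P_eq[OF fin])
  next
    assume diff: "xb \<in> diffdom_Lam0_star \<Phi> T"
    note sol = sol_P_iff[OF diff fin] sol_D2_iff[OF diff fin] and Feq = Fenchel_equality_iff[OF diff fin]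
    obtain l where "T l = xb" "Phi_star \<Phi> l = Lam0_star \<Phi> T xb"
      using Lam0_star_attained[OF fin] .
    then show "\<exists>l\<in>L1 \<Phi>. l \<in> sol_P \<Phi> T xb"
      using fin Phi_star_finite_L1[of l] sol(1)[of l] by auto
    show dual: "\<exists>\<omega>\<in>adual_on (X1 \<Phi> T). \<omega> \<in> sol_D2 \<Phi> T xb"
      using dual_attained[OF diff fin] unfolding sol(2) by blast
    \<comment> \<open>Any dual solution can serve as the witness for every primal solution, so one
      existing dual solution settles the forward direction.\<close>
    show "\<forall>l\<in>L1 \<Phi>. l \<in> sol_P \<Phi> T xb \<longleftrightarrow>
        T l = xb \<and> (\<exists>\<omega>\<in>adual_on (X1 \<Phi> T). l \<in> subdiff_Phi2 \<Phi> (T2star \<Phi> T \<omega>))"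
      using dual Feq by blast
    show "\<forall>l\<in>L1 \<Phi>. \<forall>\<omega>\<in>adual_on (X1 \<Phi> T).
        l \<in> subdiff_Phi2 \<Phi> (T2star \<Phi> T \<omega>) \<longleftrightarrow>
        Phi_star \<Phi> l + Phi2 \<Phi> (T2star \<Phi> T \<omega>) = ereal (\<omega> (T l))"
      by (simp add: subdiff_Phi2_iff T2star_adual T2star_apply)
    show "\<forall>l\<in>L1 \<Phi>. \<forall>\<omega>\<in>adual_on (X1 \<Phi> T).
        (T l = xb \<and> l \<in> subdiff_Phi2 \<Phi> (T2star \<Phi> T \<omega>)) \<longleftrightarrow>
        (l \<in> sol_P \<Phi> T xb \<and> \<omega> \<in> sol_D2 \<Phi> T xb \<and> xb = T l \<and> inf_P \<Phi> T xb = sup_D2 \<Phi> T xb)"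
      using Feq sol(1) inf_P_eq[OF fin] sup_D2_eq[OF diff fin] by auto
    show "\<forall>\<omega>\<in>sol_D2 \<Phi> T xb.
         \<omega> \<in> weak_top (X1 \<Phi> T) closure_of (cemb (lux (Lam \<Phi> T)) ` dom_Lam1 \<Phi> T) \<and>
         T2star \<Phi> T \<omega> \<in> weak_top (L1 \<Phi>) closure_of
            (cemb (lux \<Phi>) ` T1star \<Phi> T ` dom_Lam1 \<Phi> T) \<and>
         T2star \<Phi> T \<omega> \<in> weak_top (L1 \<Phi>) closure_of
            ((\<lambda>u. restrict (app (canon u)) (L1 \<Phi>)) ` edom \<Phi>) \<and>
         (xb \<in> icor (edom (Lam0_star \<Phi> T)) \<longrightarrow>
            gauge_usc (X1 \<Phi> T) (gauge_fun (Dset \<Phi> T xb)) \<omega> \<and>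
            gauge_lsc (X1 \<Phi> T) (gauge_fun (uminus ` Dset \<Phi> T xb)) \<omega>)"
    proof (intro ballI conjI impI)
      fix \<omega> assume \<omega>: "\<omega> \<in> sol_D2 \<Phi> T xb"
      then have dual: "\<omega> \<in> adual_on (X1 \<Phi> T)"
        by (simp add: sol_D2_def)
      obtain m where "Lam2 \<Phi> T \<omega> = ereal m"
        using sol_D2_Lam2[OF diff fin \<omega>] by blast
      then have Lam2: "Lam2 \<Phi> T \<omega> < \<infinity>" by simp
      show "\<omega> \<in> weak_top (X1 \<Phi> T) closure_of (cemb (lux (Lam \<Phi> T)) ` dom_Lam1 \<Phi> T)"
        by (rule Lam2_finite_closure[OF dual Lam2])
      show "T2star \<Phi> T \<omega> \<in> weak_top (L1 \<Phi>) closure_of (cemb (lux \<Phi>) ` T1star \<Phi> T ` dom_Lam1 \<Phi> T)"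
      proof (rule T2star_closure[OF dual Lam2])
        fix y assume "\<Lambda> y < \<infinity>"
        then show "(\<lambda>l\<in>L1 \<Phi>. \<langle>Tstar T y, l\<rangle>) \<in> cemb (lux \<Phi>) ` T1star \<Phi> T ` dom_Lam1 \<Phi> T"
          unfolding cemb_T1star_const_class[symmetric] by (intro imageI const_class_dom_Lam1)
      qed
      \<comment> \<open>Since \<open>\<Lambda> y\<close> is the value of \<Phi> at
        \<open>Tstar T y\<close>, the approximants are evaluations at points of
        \<open>edom \<Phi>\<close>.\<close>
      show "T2star \<Phi> T \<omega> \<in> weak_top (L1 \<Phi>) closure_of
          ((\<lambda>u. restrict (app (canon u)) (L1 \<Phi>)) ` edom \<Phi>)"
      proof (rule T2star_closure[OF dual Lam2])
        fix y assume "\<Lambda> y < \<infinity>"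
        then show "(\<lambda>l\<in>L1 \<Phi>. \<langle>Tstar T y, l\<rangle>) \<in> (\<lambda>u. restrict (app (canon u)) (L1 \<Phi>)) ` edom \<Phi>"
          by (intro image_eqI[of _ _ "Tstar T y"]) (auto simp: Lam_def edom_def restrict_def fun_eq_iff)
      qed
      show "gauge_usc (X1 \<Phi> T) (gauge_fun (Dset \<Phi> T xb)) \<omega>"
        "gauge_lsc (X1 \<Phi> T) (gauge_fun (uminus ` Dset \<Phi> T xb)) \<omega>"
        using gauge_semicontinuous[OF sol_D2_subgradient[OF diff fin \<omega>] diffdom_X1[OF diff fin] fin dual]
        by simp_all
    qed
  qed
qed

end
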